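(* For every $u>0$ there is a constant $C=C(u)>0$ such that for every Dirichlet series $D=\sum a_n n^{-s}\in\mathcal{H}_1$ we have $$\int_{\Xi}\sup_{x\in\mathbb{N}}\Big|\sum_{n=1}^{x}\frac{a_n}{n^u}\chi(n)\Big|\, d\chi\le C\,\|D\|_1 .$$ Equivalently, for every $f\in H_1(\mathbb{T}^\infty)$, $$\int_{\mathbb{T}^\infty}\sup_{x>0}\Big|\sum_{\mathfrak{p}^\alpha<x}\frac{\widehat f(\alpha)}{\mathfrak{p}^{u\alpha}}z^\alpha\Big|\,dz\le C\,\|f\|_1 .$$
   Context: $\mathbb{T}=\{w\in\mathbb{C}:|w|=1\}$; $\mathbb{T}^\infty$ is the countable product of copies of $\mathbb{T}$, a compact abelian group with normalized Haar measure $dz$. $\mathfrak{p}=(p_k)_{k\ge1}=(2,3,5,\dots)$ is the sequence of primes. For a finitely supported integer sequence $\alpha\in\mathbb{Z}^{(\mathbb{N})}$ put $z^\alpha=\prod_k z_k^{\alpha_k}$, $\mathfrak{p}^\alpha=\prod_k p_k^{\alpha_k}$ and $\mathfrak{p}^{u\alpha}=(\mathfrak{p}^\alpha)^u$; $\widehat f(\alpha)=\int_{\mathbb{T}^\infty}f(z)\overline{z^\alpha}\,dz$. $H_p(\mathbb{T}^\infty)$, $1\le p\le\infty$, is the closed subspace of those $f\in L_p(\mathbb{T}^\infty)$ with $\widehat f(\alpha)=0$ for $\alpha\notin\mathbb{N}_0^{(\mathbb{N})}$ (finitely supported sequences of nonnegative integers); sums over $\mathfrak{p}^\alpha<x$ run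 over $\alpha\in\mathbb{N}_0^{(\mathbb{N})}$. $\mathcal{H}_p$ is the space of all (formal) Dirichlet series $D=\sum a_n n^{-s}$ for which there is a (unique) $f\in H_p(\mathbb{T}^\infty)$ with $a_n=\widehat f(\alpha)$ whenever $n=\mathfrak{p}^\alpha$, $\alpha\in\mathbb{N}_0^{(\mathbb{N})}$; its norm is $\|D\|_p=\|f\|_p$. $\Xi$ is the set of all completely multiplicative functions $\chi:\mathbb{N}\to\mathbb{T}$, identified with $\mathbb{T}^\infty$ via the group isomorphism $\chi\mapsto(\chi(p_k))_k$; $d\chi$ is the Haar measure corresponding to $dz$ under this identification. *)

theory Defs
  imports "HOL-Probability.Probability" "HOL-Library.Poly_Mapping"
    "HOL-Computational_Algebra.Primes"
begin

subsection \<open>The infinite torus\<close>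

definition circle :: "complex measure" where
  "circle = distr (uniform_measure lborel {0..<1::real}) (restrict_space borel (sphere 0 1))
     (\<lambda>t. cis (2 * pi * t))"

text \<open>
  The normalized Haar measure of a countable product of circles is the product of the normalized
  arc length measures; its invariance is proved in \<open>torus_rotation_invariant\<close>.
  Coordinates are indexed from 0.
\<close>

definition torus :: "(nat \<Rightarrow> complex) measure" where
  "torus = (\<Pi>\<^sub>M k\<in>UNIV. circle)"

lemma space_circle: "space circle = sphere 0 1"
  by (simp add: circle_def space_restrict_space)

lemma sets_circle: "sets circle = sets (restrict_space borel (sphere 0 1))"
  by (simp add: circle_def)

lemma space_torus: "space torus = (UNIV \<rightarrow> sphere 0 1)"
  by (simp add: torus_def space_PiM space_circle PiE_UNIV_domain)

lemma cis_measurable_circle: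
  "(\<lambda>t. cis (2 * pi * t)) \<in> borel \<rightarrow>\<^sub>M restrict_space borel (sphere 0 1)"
  by (intro measurable_restrict_space2)
     (auto intro!: borel_measurable_continuous_onI continuous_intros)

interpretation unit_interval: prob_space "uniform_measure lborel {0..<1::real}"
  by (rule prob_space_uniform_measure) auto

lemma prob_space_circle: "prob_space circle"
  unfolding circle_def
  by (rule unit_interval.prob_space_distr) (use cis_measurable_circle in simp)

lemma prob_space_torus: "prob_space torus"
  unfolding torus_def by (rule prob_space_PiM) (rule prob_space_circle)

lemma nn_integral_unit_interval_shift:
  fixes g :: "real \<Rightarrow> ennreal"
  assumes [measurable]: "g \<in> borel_measurable borel"
    and per: "\<And>t. g (t + 1) = g t" and s: "0 \<le> s" "s < 1"
  shows "(\<integral>\<^sup>+t\<in>{0..<1}. g (s + t) \<partial>lborel) = (\<integral>\<^sup>+t\<in>{0..<1}. g t \<partial>lborel)"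
proof -
  have "(\<integral>\<^sup>+t\<in>{0..<1}. g (s + t) \<partial>lborel)
      = (\<integral>\<^sup>+t. g (s + 1 * t) * indicator {s..<s+1} (s + 1 * t) \<partial>lborel)"
    by (intro nn_integral_cong) (auto simp: indicator_def)
  also have "\<dots> = (\<integral>\<^sup>+t\<in>{s..<s+1}. g t \<partial>lborel)"
    by (subst (2) nn_integral_real_affine[where c = 1 and t = s]) auto
  also have "\<dots> = (\<integral>\<^sup>+t. g t * indicator {s..<1} t + g t * indicator {1..<s+1} t \<partial>lborel)"
    using s by (intro nn_integral_cong) (auto simp: indicator_def)
  also have "\<dots> = (\<integral>\<^sup>+t\<in>{s..<1}. g t \<partial>lborel) + (\<integral>\<^sup>+t\<in>{1..<s+1}. g t \<partial>lborel)"
    by (rule nn_integral_add) auto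
  also have "(\<integral>\<^sup>+t\<in>{1..<s+1}. g t \<partial>lborel)
      = (\<integral>\<^sup>+t. g (1 + 1 * t) * indicator {1..<s+1} (1 + 1 * t) \<partial>lborel)"
    by (subst nn_integral_real_affine[where c = 1 and t = 1]) auto
  also have "\<dots> = (\<integral>\<^sup>+t\<in>{0..<s}. g t \<partial>lborel)"
    using per by (intro nn_integral_cong) (auto simp: indicator_def add.commute)
  also have "(\<integral>\<^sup>+t\<in>{s..<1}. g t \<partial>lborel) + (\<integral>\<^sup>+t\<in>{0..<s}. g t \<partial>lborel)
      = (\<integral>\<^sup>+t. g t * indicator {s..<1} t + g t * indicator {0..<s} t \<partial>lborel)"
    by (rule nn_integral_add[symmetric]) auto
  also have "\<dots> = (\<integral>\<^sup>+t\<in>{0..<1}. g t \<partial>lborel)"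
    using s by (intro nn_integral_cong) (auto simp: indicator_def)
  finally show ?thesis .
qed

lemma emeasure_circle:
  assumes "A \<in> sets circle"
  shows "emeasure circle A = (\<integral>\<^sup>+t\<in>{0..<1}. indicator A (cis (2 * pi * t)) \<partial>lborel)"
proof -
  have A: "A \<in> sets (restrict_space borel (sphere 0 1))"
    using assms by (simp add: sets_circle)
  have m: "(\<lambda>t. cis (2 * pi * t)) -` A \<in> sets borel"
    using measurable_sets[OF cis_measurable_circle A] by simp
  have "emeasure circle A
      = emeasure (uniform_measure lborel {0..<1::real}) ((\<lambda>t. cis (2 * pi * t)) -` A)"
    unfolding circle_def using A cis_measurable_circle by (subst emeasure_distr) auto
  also have "\<dots> = emeasure lborel ({0..<1} \<inter> (\<lambda>t. cis (2 * pi * t)) -` A)"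
    using m by (simp add: emeasure_uniform_measure divide_ennreal_def)
  also have "\<dots> = (\<integral>\<^sup>+t. indicator ({0..<1} \<inter> (\<lambda>t. cis (2 * pi * t)) -` A) t \<partial>lborel)"
    using m by (intro nn_integral_indicator[symmetric]) auto
  also have "\<dots> = (\<integral>\<^sup>+t\<in>{0..<1}. indicator A (cis (2 * pi * t)) \<partial>lborel)"
    by (intro nn_integral_cong) (auto simp: indicator_def)
  finally show ?thesis .
qed

lemma rotation_measurable:
  assumes "norm w = 1"
  shows "(\<lambda>v. w * v) \<in> circle \<rightarrow>\<^sub>M circle"
proof -
  have "(\<lambda>v. w * v) \<in> restrict_space borel (sphere 0 1) \<rightarrow>\<^sub>M restrict_space borel (sphere 0 1)"
    using assms
    by (intro measurable_restrict_space3)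
       (auto simp: norm_mult intro!: borel_measurable_continuous_onI continuous_intros)
  then show ?thesis
    by (simp add: measurable_cong_sets[OF sets_circle sets_circle])
qed

lemma circle_rotation_invariant:
  assumes w: "norm w = 1"
  shows "distr circle circle (\<lambda>v. w * v) = circle"
proof (rule measure_eqI)
  fix A assume "A \<in> sets (distr circle circle (\<lambda>v. w * v))"
  then have A: "A \<in> sets circle" by simp
  define s where "s = frac (Arg w / (2 * pi))"
  have s: "0 \<le> s" "s < 1" by (auto simp: s_def frac_lt_1)
  have "2 * pi * s = Arg w + 2 * pi * of_int (- \<lfloor>Arg w / (2 * pi)\<rfloor>)"
    by (simp add: s_def frac_def algebra_simps)
  then have "cis (2 * pi * s) = cis (Arg w) * cis (2 * pi * of_int (- \<lfloor>Arg w / (2 * pi)\<rfloor>))"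
    by (simp only: cis_mult)
  also have "cis (2 * pi * of_int (- \<lfloor>Arg w / (2 * pi)\<rfloor>)) = 1"
    by (rule cis_multiple_2pi) auto
  also have "cis (Arg w) = w"
    using w rcis_cmod_Arg[of w] by (simp add: rcis_def)
  finally have ws: "w = cis (2 * pi * s)" by simp
  have A': "A \<in> sets (restrict_space borel (sphere 0 1))"
    using A by (simp add: sets_circle)
  have meas: "(\<lambda>t. indicator A (cis (2 * pi * t)) :: ennreal) \<in> borel_measurable borel"
    using measurable_compose[OF cis_measurable_circle borel_measurable_indicator[OF A']] .
  have pre: "(\<lambda>v. w * v) -` A \<inter> space circle \<in> sets circle"
    by (rule measurable_sets[OF rotation_measurable[OF w] A])
  have "emeasure (distr circle circle (\<lambda>v. w * v)) A
      = emeasure circle ((\<lambda>v. w * v) -` A \<inter> space circle)"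
    by (rule emeasure_distr[OF rotation_measurable[OF w] A])
  also have "\<dots> = (\<integral>\<^sup>+t\<in>{0..<1}.
      indicator ((\<lambda>v. w * v) -` A \<inter> space circle) (cis (2 * pi * t)) \<partial>lborel)"
    by (rule emeasure_circle[OF pre])
  also have "\<dots> = (\<integral>\<^sup>+t\<in>{0..<1}. indicator A (cis (2 * pi * (s + t))) \<partial>lborel)"
    by (intro nn_integral_cong)
       (auto simp: indicator_def space_circle ws cis_mult distrib_left)
  also have "\<dots> = (\<integral>\<^sup>+t\<in>{0..<1}. indicator A (cis (2 * pi * t)) \<partial>lborel)"
    by (rule nn_integral_unit_interval_shift[OF meas _ s])
       (simp add: distrib_left cis_mult[symmetric])
  also have "\<dots> = emeasure circle A"
    by (rule emeasure_circle[OF A, symmetric])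
  finally show "emeasure (distr circle circle (\<lambda>v. w * v)) A = emeasure circle A" .
qed simp

lemma torus_rotation_invariant:
  assumes "w \<in> space torus"
  shows "distr torus torus (\<lambda>z k. w k * z k) = torus"
proof -
  have w: "norm (w k) = 1" for k
    using assms by (auto simp: space_torus)
  interpret circle: prob_space circle by (rule prob_space_circle)
  interpret product_prob_space "\<lambda>_. circle" "UNIV :: nat set" ..
  have meas: "(\<lambda>z k. w k * z k) \<in> torus \<rightarrow>\<^sub>M torus"
    unfolding torus_def
  proof (rule measurable_PiM_single')
    fix k
    show "(\<lambda>z. w k * z k) \<in> (\<Pi>\<^sub>M k\<in>UNIV. circle) \<rightarrow>\<^sub>M circle"
      by (rule measurable_compose[OF _ rotation_measurable[OF w]])
         (rule measurable_component_singleton, simp)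
  next
    show "(\<lambda>z k. w k * z k) \<in> space (\<Pi>\<^sub>M k\<in>UNIV. circle) \<rightarrow> (\<Pi>\<^sub>E k\<in>UNIV. space circle)"
      by (simp add: space_PiM space_circle norm_mult w PiE_UNIV_domain Pi_iff)
  qed
  have "distr torus torus (\<lambda>z k. w k * z k) = (\<Pi>\<^sub>M k\<in>UNIV. circle)"
  proof (rule PiM_eq)
    fix J and F :: "nat \<Rightarrow> complex set"
    assume J: "finite J" and F: "\<And>j. j \<in> J \<Longrightarrow> F j \<in> sets circle"
    define G where "G k = (\<lambda>v. w k * v) -` F k \<inter> space circle" for k
    have G: "G j \<in> sets circle" if "j \<in> J" for j
      unfolding G_def by (rule measurable_sets[OF rotation_measurable[OF w] F[OF that]])
    have E: "prod_emb UNIV (\<lambda>_. circle) J (\<Pi>\<^sub>E j\<in>J. F j) \<in> sets torus"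
      unfolding torus_def using J F by (intro sets_PiM_I) auto
    have "emeasure (distr torus torus (\<lambda>z k. w k * z k))
          (prod_emb UNIV (\<lambda>_. circle) J (\<Pi>\<^sub>E j\<in>J. F j))
        = emeasure torus ((\<lambda>z k. w k * z k) -` prod_emb UNIV (\<lambda>_. circle) J (\<Pi>\<^sub>E j\<in>J. F j)
            \<inter> space torus)"
      by (rule emeasure_distr[OF meas E])
    also have "(\<lambda>z k. w k * z k) -` prod_emb UNIV (\<lambda>_. circle) J (\<Pi>\<^sub>E j\<in>J. F j) \<inter> space torus
        = prod_emb UNIV (\<lambda>_. circle) J (\<Pi>\<^sub>E j\<in>J. G j)"
      (is "?L = ?R")
    proof (rule set_eqI)
      fix z :: "nat \<Rightarrow> complex"
      show "z \<in> ?L \<longleftrightarrow> z \<in> ?R"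
        by (simp add: prod_emb_def space_torus space_circle G_def PiE_iff norm_mult w
              PiE_UNIV_domain Pi_iff) blast
    qed
    also have "emeasure torus \<dots> = (\<Prod>j\<in>J. emeasure circle (G j))"
      unfolding torus_def using J G by (intro emeasure_PiM_emb) auto
    also have "\<dots> = (\<Prod>j\<in>J. emeasure (distr circle circle (\<lambda>v. w j * v)) (F j))"
      by (intro prod.cong refl) (simp add: G_def emeasure_distr[OF rotation_measurable[OF w] F])
    also have "\<dots> = (\<Prod>j\<in>J. emeasure circle (F j))"
      by (simp add: circle_rotation_invariant w)
    finally show "emeasure (distr torus torus (\<lambda>z k. w k * z k))
          (prod_emb UNIV (\<lambda>_. circle) J (\<Pi>\<^sub>E j\<in>J. F j)) = (\<Prod>j\<in>J. emeasure circle (F j))" .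
  qed (simp add: torus_def)
  then show ?thesis by (simp add: torus_def)
qed


subsection \<open>Multi-indices\<close>

definition nth_prime :: "nat \<Rightarrow> nat" where
  "nth_prime = enumerate {p. prime p}"

text \<open>Both \<open>z\<^sup>\<alpha>\<close> and \<open>\<pp>\<^sup>\<alpha>\<close> are instances of the following.\<close>

definition monomial :: "(nat \<Rightarrow> 'a::field) \<Rightarrow> (nat \<Rightarrow>\<^sub>0 int) \<Rightarrow> 'a" where
  "monomial z \<alpha> = (\<Prod>k\<in>Poly_Mapping.keys \<alpha>. z k powi Poly_Mapping.lookup \<alpha> k)"

definition prime_power :: "(nat \<Rightarrow>\<^sub>0 int) \<Rightarrow> real" where
  "prime_power \<alpha> = monomial (\<lambda>k. real (nth_prime k)) \<alpha>"

definition nonneg_indices :: "(nat \<Rightarrow>\<^sub>0 int) set" where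
  "nonneg_indices = {\<alpha>. \<forall>k. 0 \<le> Poly_Mapping.lookup \<alpha> k}"

lemma bij_nth_prime: "bij_betw nth_prime UNIV {p. prime p}"
  unfolding nth_prime_def by (rule bij_enumerate) (rule primes_infinite)

lemma prime_nth_prime: "prime (nth_prime k)"
  using bij_nth_prime by (auto simp: bij_betw_def)

lemma finite_prime_power_less: "finite {\<alpha> \<in> nonneg_indices. prime_power \<alpha> < x}"
proof -
  define m where "m = nat \<lceil>x\<rceil>"
  have bound: "real (nat (Poly_Mapping.lookup \<alpha> k)) < x \<and> real k < x"
    if \<alpha>: "\<alpha> \<in> nonneg_indices" "prime_power \<alpha> < x" and k: "k \<in> Poly_Mapping.keys \<alpha>" for \<alpha> k
  proof -
    define e where "e = nat (Poly_Mapping.lookup \<alpha> k)"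
    have pos: "Poly_Mapping.lookup \<alpha> k > 0"
      using \<alpha> k by (auto simp: nonneg_indices_def in_keys_iff order.order_iff_strict)
    have ge1: "1 \<le> real (nth_prime j) powi Poly_Mapping.lookup \<alpha> j" for j
      using \<alpha> prime_gt_1_nat[OF prime_nth_prime, of j]
      by (auto simp: nonneg_indices_def power_int_def intro!: one_le_power)
    have "real (nth_prime k) powi Poly_Mapping.lookup \<alpha> k
        \<le> real (nth_prime k) powi Poly_Mapping.lookup \<alpha> k
          * (\<Prod>j\<in>Poly_Mapping.keys \<alpha> - {k}. real (nth_prime j) powi Poly_Mapping.lookup \<alpha> j)"
    proof -
      have "1 \<le> (\<Prod>j\<in>Poly_Mapping.keys \<alpha> - {k}.
          real (nth_prime j) powi Poly_Mapping.lookup \<alpha> j)"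
        by (rule prod_ge_1) (rule ge1)
      from mult_left_mono[OF this order_trans[OF zero_le_one ge1[of k]]] show ?thesis by simp
    qed
    also have "\<dots> = prime_power \<alpha>"
      using k unfolding prime_power_def monomial_def by (subst prod.remove[of _ k]) auto
    finally have le: "real (nth_prime k ^ e) < x"
      using \<alpha>(2) pos by (simp add: power_int_def e_def)
    have e: "e > 0" using pos by (simp add: e_def)
    have "e < nth_prime k ^ e"
      using prime_gt_1_nat[OF prime_nth_prime, of k]
      by (metis less_exp order_less_le_trans power_mono prime_ge_2_nat prime_nth_prime zero_le_numeral)
    moreover have "nth_prime k \<le> nth_prime k ^ e"
      using e prime_gt_0_nat[OF prime_nth_prime, of k] by (intro self_le_power) auto
    moreover have "k \<le> nth_prime k"
      unfolding nth_prime_def by (rule le_enumerate) (rule primes_infinite)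
    ultimately have "real e \<le> real (nth_prime k ^ e)" "real k \<le> real (nth_prime k ^ e)"
      by (simp_all only: of_nat_le_iff)
    then show ?thesis using le unfolding e_def[symmetric] by linarith
  qed
  have "Poly_Mapping.lookup ` {\<alpha> \<in> nonneg_indices. prime_power \<alpha> < x}
      \<subseteq> {f. \<forall>k. (k \<in> {..m} \<longrightarrow> f k \<in> {0..int m}) \<and> (k \<notin> {..m} \<longrightarrow> f k = 0)}"
  proof (intro image_subsetI CollectI allI conjI impI)
    fix \<alpha> k assume "\<alpha> \<in> {\<alpha> \<in> nonneg_indices. prime_power \<alpha> < x}"
    then have \<alpha>: "\<alpha> \<in> nonneg_indices" "prime_power \<alpha> < x" by auto
    have ge: "0 \<le> Poly_Mapping.lookup \<alpha> k" using \<alpha> by (simp add: nonneg_indices_def)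
    show "Poly_Mapping.lookup \<alpha> k \<in> {0..int m}"
    proof (cases "k \<in> Poly_Mapping.keys \<alpha>")
      case True
      have "real_of_int (Poly_Mapping.lookup \<alpha> k) < x"
        using bound[OF \<alpha> True] ge by simp
      then show ?thesis using ge unfolding m_def by simp linarith
    next
      case False
      then show ?thesis by (simp add: in_keys_iff)
    qed
    assume "k \<notin> {..m}"
    then have "\<not> real k < x" unfolding m_def by simp linarith
    then show "Poly_Mapping.lookup \<alpha> k = 0"
      using bound[OF \<alpha>, of k] by (auto simp: in_keys_iff)
  qed
  moreover have "finite {f. \<forall>k. (k \<in> {..m} \<longrightarrow> f k \<in> {0..int m}) \<and> (k \<notin> {..m} \<longrightarrow> f k = 0)}"
    by (rule finite_set_of_finite_funs) auto
  ultimately have "finite (Poly_Mapping.lookup ` {\<alpha> \<in> nonneg_indices. prime_power \<alpha> < x})"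
    by (rule finite_subset)
  then show ?thesis
    by (rule finite_imageD) (auto simp: inj_on_def poly_mapping_eqI)
qed


subsection \<open>Hardy spaces of functions and of Dirichlet series\<close>

definition fourier_coeff :: "((nat \<Rightarrow> complex) \<Rightarrow> complex) \<Rightarrow> (nat \<Rightarrow>\<^sub>0 int) \<Rightarrow> complex" where
  "fourier_coeff f \<alpha> = (LINT z|torus. f z * cnj (monomial z \<alpha>))"

text \<open>Elements of \<open>H\<^sub>1\<close> are given by representatives, not by classes modulo null sets.\<close>

definition hardy_H1 :: "((nat \<Rightarrow> complex) \<Rightarrow> complex) set" where
  "hardy_H1 = {f. integrable torus f \<and> (\<forall>\<alpha>. \<alpha> \<notin> nonneg_indices \<longrightarrow> fourier_coeff f \<alpha> = 0)}"

definition L1_norm :: "((nat \<Rightarrow> complex) \<Rightarrow> complex) \<Rightarrow> real" where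
  "L1_norm f = (LINT z|torus. norm (f z))"

text \<open>
  A formal Dirichlet series is given by its coefficients \<open>a n\<close> for \<open>n \<ge> 1\<close>; the value \<open>a 0\<close>
  is never used.
\<close>

definition bohr_lift :: "(nat \<Rightarrow> complex) \<Rightarrow> ((nat \<Rightarrow> complex) \<Rightarrow> complex) \<Rightarrow> bool" where
  "bohr_lift a f \<longleftrightarrow>
     f \<in> hardy_H1 \<and>
     (\<forall>n. \<forall>\<alpha>\<in>nonneg_indices. real n = prime_power \<alpha> \<longrightarrow> a n = fourier_coeff f \<alpha>)"

definition dirichlet_H1 :: "(nat \<Rightarrow> complex) set" where
  "dirichlet_H1 = {a. \<exists>f. bohr_lift a f}"

text \<open>The lift is unique almost everywhere, so the choice does not affect the norm.\<close>

definition dirichlet_H1_norm :: "(nat \<Rightarrow> complex) \<Rightarrow> real" where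
  "dirichlet_H1_norm a = L1_norm (SOME f. bohr_lift a f)"


subsection \<open>Completely multiplicative characters\<close>

text \<open>
  Functions on the positive integers are made extensional, so that they are equal as soon
  as they agree for \<open>n \<ge> 1\<close>. Complete multiplicativity forces \<open>\<xi> 1 = 1\<close>.
  (The letter chi is a binder in HOL-Analysis.)
\<close>

definition Xi :: "(nat \<Rightarrow> complex) set" where
  "Xi = {\<xi> \<in> {1..} \<rightarrow>\<^sub>E sphere 0 1. \<forall>m\<ge>1. \<forall>n\<ge>1. \<xi> (m * n) = \<xi> m * \<xi> n}"

definition prime_values :: "(nat \<Rightarrow> complex) \<Rightarrow> nat \<Rightarrow> complex" where
  "prime_values \<xi> = (\<lambda>k. \<xi> (nth_prime k))"

definition Xi_haar :: "(nat \<Rightarrow> complex) measure" where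
  "Xi_haar = distr torus (vimage_algebra Xi prime_values torus) (the_inv_into Xi prime_values)"

lemma Xi_one:
  assumes "\<xi> \<in> Xi" shows "\<xi> 1 = 1"
proof -
  have mult: "\<xi> (m * n) = \<xi> m * \<xi> n" if "m \<ge> 1" "n \<ge> 1" for m n
    using assms that by (simp add: Xi_def)
  have "\<xi> 1 = \<xi> 1 * \<xi> 1" using mult[of 1 1] by simp
  moreover have "\<xi> 1 \<in> sphere 0 1" using assms by (auto simp: Xi_def)
  ultimately show ?thesis by auto
qed

lemma bij_prime_values: "bij_betw prime_values Xi (space torus)"
proof (rule bij_betwI')
  fix \<xi> \<psi> assume \<xi>: "\<xi> \<in> Xi" and \<psi>: "\<psi> \<in> Xi"
  show "prime_values \<xi> = prime_values \<psi> \<longleftrightarrow> \<xi> = \<psi>"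
  proof
    assume eq: "prime_values \<xi> = prime_values \<psi>"
    have pr: "\<xi> p = \<psi> p" if "prime p" for p
    proof -
      have "p \<in> range nth_prime"
        using that by (simp add: bij_betw_imp_surj_on[OF bij_nth_prime])
      then obtain k where "p = nth_prime k" by (rule rangeE)
      then show ?thesis using fun_cong[OF eq, of k] by (simp add: prime_values_def)
    qed
    have "n \<ge> 1 \<longrightarrow> \<xi> n = \<psi> n" for n
    proof (induction n rule: prime_divisors_induct)
      case (factor p n)
      show ?case
      proof
        assume "p * n \<ge> 1"
        then have pn: "p \<ge> 1" "n \<ge> 1" by (simp_all add: Suc_le_eq)
        have "\<xi> (p * n) = \<xi> p * \<xi> n" using \<xi> pn unfolding Xi_def by blast
        also have "\<dots> = \<psi> p * \<psi> n" using factor pn pr by simp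
        also have "\<dots> = \<psi> (p * n)" using \<psi> pn unfolding Xi_def by simp
        finally show "\<xi> (p * n) = \<psi> (p * n)" .
      qed
    next
      case (unit n)
      then have "n = 1" by simp
      then show ?case using Xi_one[OF \<xi>] Xi_one[OF \<psi>] by simp
    qed simp
    then have "\<xi> n = \<psi> n" if "n \<in> {1..}" for n using that by simp
    moreover have "\<xi> \<in> {1..} \<rightarrow>\<^sub>E sphere 0 1" "\<psi> \<in> {1..} \<rightarrow>\<^sub>E sphere 0 1"
      using \<xi> \<psi> unfolding Xi_def by blast+
    ultimately show "\<xi> = \<psi>" by (intro PiE_ext)
  qed simp
next
  fix \<xi> assume \<xi>: "\<xi> \<in> Xi"
  have "nth_prime k \<in> {1..}" for k
    using prime_gt_0_nat[OF prime_nth_prime, of k] by simp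
  moreover have "\<xi> \<in> {1..} \<rightarrow>\<^sub>E sphere 0 1" using \<xi> unfolding Xi_def by blast
  ultimately have "\<xi> (nth_prime k) \<in> sphere 0 1" for k by (metis PiE_mem)
  then show "prime_values \<xi> \<in> space torus"
    unfolding space_torus prime_values_def by blast
next
  fix z assume z: "z \<in> space torus"
  define ix where "ix = the_inv_into UNIV nth_prime"
  have ix: "ix (nth_prime k) = k" for k
    unfolding ix_def using bij_nth_prime by (intro the_inv_into_f_f) (auto simp: bij_betw_def)
  define \<xi> where "\<xi> = restrict (\<lambda>n. \<Prod>p\<in>#prime_factorization n. z (ix p)) {1..}"
  have z1: "norm (z k) = 1" for k using z by (auto simp: space_torus)
  have "norm (\<Prod>p\<in>#M. z (ix p)) = 1" for M
    by (induction M) (auto simp: norm_mult z1)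
  then have "\<xi> \<in> {1..} \<rightarrow>\<^sub>E sphere 0 1"
    unfolding \<xi>_def by (intro restrict_PiE_iff[THEN iffD2]) simp
  moreover have "\<xi> (m * n) = \<xi> m * \<xi> n" if "m \<ge> 1" "n \<ge> 1" for m n
    using that by (simp add: \<xi>_def prime_factorization_mult Suc_le_eq)
  ultimately have "\<xi> \<in> Xi" unfolding Xi_def by blast
  moreover have "prime_values \<xi> = z"
  proof
    fix k
    show "prime_values \<xi> k = z k"
      using prime_gt_0_nat[OF prime_nth_prime, of k]
      by (simp add: prime_values_def \<xi>_def prime_factorization_prime prime_nth_prime ix)
  qed
  ultimately show "\<exists>\<xi>\<in>Xi. z = prime_values \<xi>" by blast
qed

lemma measurable_the_inv_prime_values:
  "the_inv_into Xi prime_values \<in> torus \<rightarrow>\<^sub>M vimage_algebra Xi prime_values torus"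
proof (rule measurable_vimage_algebra2)
  show "the_inv_into Xi prime_values \<in> space torus \<rightarrow> Xi"
    using bij_betw_the_inv_into[OF bij_prime_values] by (auto simp: bij_betw_def)
  have "prime_values (the_inv_into Xi prime_values z) = z" if "z \<in> space torus" for z
    by (rule f_the_inv_into_f_bij_betw[OF bij_prime_values that])
  then show "(\<lambda>z. prime_values (the_inv_into Xi prime_values z)) \<in> torus \<rightarrow>\<^sub>M torus"
    by (subst measurable_cong[where g = "\<lambda>z. z"]) auto
qed

end

theory Submission
  imports Defs
begin

text \<open>
  Rotation by \<open>flow t = (p\<^sub>k powr (-i t))\<^sub>k\<close> preserves the Haar measure and multiplies the Fourier
  coefficient at \<open>\<alpha>\<close> by \<open>exp (-i t l)\<close> with \<open>l = ln (\<pp>\<^sup>\<alpha>)\<close>. Averaging \<open>f\<close> over these rotations against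
  a kernel \<open>K\<close> on the line therefore multiplies the coefficients by the Fourier transform of \<open>K\<close> at \<open>l\<close>.
  Only the values \<open>l = ln n\<close> occur, so the cutoff at \<open>N\<close> need not be sharp: the transform may pass from
  \<open>exp (-u l)\<close> to \<open>0\<close> across the gap between \<open>ln N\<close> and \<open>ln (N + 1)\<close>. The resulting kernel is at most
  \<open>N powr (-u) * min 1 (N / \<bar>t\<bar>) / (1 + \<bar>t\<bar>)\<close> up to a constant, and the supremum of this over
  \<open>N\<close> is of order \<open>\<bar>t\<bar> powr (-1 - min u 1)\<close>, which is integrable. Hence one fixed \<open>L\<^sub>1\<close> kernel convolved
  with \<open>\<bar>f\<bar>\<close> along the flow dominates all the partial sums.
\<close>

subsection \<open>Fourier coefficients on the infinite torus\<close>

interpretation torus: prob_space torus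
  by (rule prob_space_torus)

lemma norm_torus_coord: "z \<in> space torus \<Longrightarrow> norm (z k) = 1"
  by (auto simp: space_torus)

lemma torus_coord_nonzero: "z \<in> space torus \<Longrightarrow> z k \<noteq> 0"
  using norm_torus_coord[of z k] by auto

lemma measurable_torus_coord [measurable]: "(\<lambda>z. z k) \<in> borel_measurable torus"
proof -
  have "(\<lambda>w::complex. w) \<in> borel_measurable circle"
    by (simp add: measurable_cong_sets[OF sets_circle refl] measurable_restrict_space1)
  then show ?thesis
    unfolding torus_def by (rule measurable_compose[rotated]) simp
qed

lemma measurable_into_torus:
  assumes "\<And>k. (\<lambda>x. g x k) \<in> borel_measurable M" "\<And>x. x \<in> space M \<Longrightarrow> g x \<in> space torus"
  shows "g \<in> M \<rightarrow>\<^sub>M torus"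
  unfolding torus_def
proof (rule measurable_PiM_single')
  fix k
  show "(\<lambda>x. g x k) \<in> M \<rightarrow>\<^sub>M circle"
    unfolding measurable_cong_sets[OF refl sets_circle]
    using assms by (intro measurable_restrict_space2) (auto simp: space_torus)
next
  show "g \<in> space M \<rightarrow> (\<Pi>\<^sub>E k\<in>UNIV. space circle)"
    using assms(2) by (auto simp: space_torus space_circle PiE_UNIV_domain)
qed

lemma mult_cnj_unit:
  assumes "norm w = 1"
  shows "w * cnj w = 1"
  using complex_norm_square[of w] assms by simp

lemma measurable_monomial [measurable]:
  "(\<lambda>z. monomial z \<alpha> :: complex) \<in> borel_measurable torus"
  unfolding monomial_def power_int_def by measurable

lemma measurable_cnj_monomial [measurable]:
  "(\<lambda>z. cnj (monomial z \<alpha>)) \<in> borel_measurable torus"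
proof -
  have "cnj \<in> borel_measurable borel"
    by (intro borel_measurable_continuous_onI continuous_on_cnj continuous_on_id)
  from measurable_compose[OF measurable_monomial this] show ?thesis .
qed

lemma monomial_superset:
  assumes "finite S" "Poly_Mapping.keys \<alpha> \<subseteq> S"
  shows "monomial z \<alpha> = (\<Prod>k\<in>S. z k powi Poly_Mapping.lookup \<alpha> k)"
  unfolding monomial_def using assms
  by (intro prod.mono_neutral_left) (auto simp: in_keys_iff)

lemma monomial_add:
  assumes "\<And>k. z k \<noteq> 0"
  shows "monomial z (\<alpha> + \<beta>) = monomial z \<alpha> * monomial z \<beta>"
proof -
  let ?S = "Poly_Mapping.keys \<alpha> \<union> Poly_Mapping.keys \<beta>"
  have "monomial z (\<alpha> + \<beta>) = (\<Prod>k\<in>?S. z k powi Poly_Mapping.lookup (\<alpha> + \<beta>) k)"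
    using Poly_Mapping.keys_add[of \<alpha> \<beta>] by (intro monomial_superset) auto
  also have "\<dots> = (\<Prod>k\<in>?S. z k powi Poly_Mapping.lookup \<alpha> k) * (\<Prod>k\<in>?S. z k powi Poly_Mapping.lookup \<beta> k)"
    using assms by (simp add: lookup_add power_int_add prod.distrib)
  also have "(\<Prod>k\<in>?S. z k powi Poly_Mapping.lookup \<alpha> k) = monomial z \<alpha>"
    by (rule monomial_superset[symmetric]) auto
  also have "(\<Prod>k\<in>?S. z k powi Poly_Mapping.lookup \<beta> k) = monomial z \<beta>"
    by (rule monomial_superset[symmetric]) auto
  finally show ?thesis .
qed

lemma monomial_mult:
  fixes z w :: "nat \<Rightarrow> 'a :: field"
  shows "monomial (\<lambda>k. w k * z k) \<alpha> = monomial w \<alpha> * monomial z \<alpha>"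
  by (simp add: monomial_def power_int_mult_distrib prod.distrib)

lemma monomial_zero [simp]: "monomial z 0 = 1"
  by (simp add: monomial_def)

lemma monomial_single: "monomial z (Poly_Mapping.single k m) = z k powi m"
  by (cases "m = 0") (simp_all add: monomial_def)

lemma norm_monomial:
  assumes "z \<in> space torus"
  shows "norm (monomial z \<alpha>) = 1"
  unfolding monomial_def prod_norm[symmetric] norm_power_int norm_torus_coord[OF assms] by simp

lemma torus_translate_measurable:
  assumes "w \<in> space torus"
  shows "(\<lambda>z k. w k * z k) \<in> torus \<rightarrow>\<^sub>M torus"
proof (rule measurable_into_torus)
  show "(\<lambda>z. w k * z k) \<in> borel_measurable torus" for k
    by measurable
  show "(\<lambda>k. w k * z k) \<in> space torus" if "z \<in> space torus" for z
    using assms that by (simp add: space_torus norm_mult Pi_iff)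
qed

lemma torus_translate_integral:
  fixes f :: "(nat \<Rightarrow> complex) \<Rightarrow> 'b :: {banach, second_countable_topology}"
  assumes "w \<in> space torus" "f \<in> borel_measurable torus"
  shows "(LINT z|torus. f (\<lambda>k. w k * z k)) = (LINT z|torus. f z)"
  using integral_distr[OF torus_translate_measurable[OF assms(1)] assms(2)]
  by (simp add: torus_rotation_invariant[OF assms(1)])

lemma torus_translate_nn_integral:
  assumes "w \<in> space torus" "f \<in> borel_measurable torus"
  shows "(\<integral>\<^sup>+z. f (\<lambda>k. w k * z k) \<partial>torus) = (\<integral>\<^sup>+z. f z \<partial>torus)"
  using nn_integral_distr[OF torus_translate_measurable[OF assms(1)], of f] assms(2)
  by (simp add: torus_rotation_invariant[OF assms(1)])

lemma integrable_mult_bounded: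
  fixes f g :: "'a \<Rightarrow> complex"
  assumes "integrable M f" "g \<in> borel_measurable M" "\<And>x. x \<in> space M \<Longrightarrow> norm (g x) \<le> B"
  shows "integrable M (\<lambda>x. g x * f x)"
proof (rule Bochner_Integration.integrable_bound)
  show "integrable M (\<lambda>x. B * norm (f x))"
    using assms(1) by simp
  show "(\<lambda>x. g x * f x) \<in> borel_measurable M"
    using assms(1,2) by measurable
  show "AE x in M. norm (g x * f x) \<le> norm (B * norm (f x))"
  proof (rule AE_I2)
    fix x assume "x \<in> space M"
    then have "norm (g x) \<le> \<bar>B\<bar>" using assms(3)[of x] by linarith
    then show "norm (g x * f x) \<le> norm (B * norm (f x))"
      by (simp add: norm_mult abs_mult mult_right_mono)
  qed
qed

lemma integrable_mult_cnj_monomial: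
  assumes "integrable torus f"
  shows "integrable torus (\<lambda>z. f z * cnj (monomial z \<alpha>))"
  using integrable_mult_bounded[OF assms, of "\<lambda>z. cnj (monomial z \<alpha>)" 1]
  by (simp add: norm_monomial mult.commute)

text \<open>Monomials are characters of the torus, so rotation invariance of the measure pulls out
  the unimodular factor \<open>monomial w \<alpha>\<close>.\<close>

lemma fourier_coeff_translate:
  assumes w: "w \<in> space torus" and f: "f \<in> borel_measurable torus"
  shows "fourier_coeff (\<lambda>z. f (\<lambda>k. w k * z k)) \<alpha> = monomial w \<alpha> * fourier_coeff f \<alpha>"
proof -
  have [simp]: "monomial w \<alpha> * cnj (monomial w \<alpha>) = 1"
    using norm_monomial[OF w, of \<alpha>] by (simp add: mult_cnj_unit)
  have "fourier_coeff f \<alpha> = (LINT z|torus. f (\<lambda>k. w k * z k) * cnj (monomial (\<lambda>k. w k * z k) \<alpha>))"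
    unfolding fourier_coeff_def using f
    by (intro torus_translate_integral[OF w, symmetric] borel_measurable_times measurable_cnj_monomial)
  also have "\<dots> = (LINT z|torus. cnj (monomial w \<alpha>) * (f (\<lambda>k. w k * z k) * cnj (monomial z \<alpha>)))"
    by (simp add: monomial_mult mult_ac)
  also have "\<dots> = cnj (monomial w \<alpha>) * fourier_coeff (\<lambda>z. f (\<lambda>k. w k * z k)) \<alpha>"
    by (simp add: fourier_coeff_def)
  finally show ?thesis
    by (simp add: mult.assoc[symmetric])
qed

section \<open>Orthogonality of the monomials\<close>

lemma integrable_monomial: "integrable torus (\<lambda>z. monomial z \<alpha>)"
  by (rule torus.integrable_const_bound[of _ 1]) (auto simp: norm_monomial)

text \<open>For distinct indices no integral is evaluated: the coefficient of a rotated monomial can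
  be computed in two ways, with the factors \<open>monomial w \<alpha>\<close> and
  \<open>monomial w \<beta>\<close>. A rotation that separates these factors forces the coefficient
  to vanish.\<close>

lemma fourier_coeff_monomial:
  "fourier_coeff (\<lambda>z. monomial z \<alpha>) \<beta> = (if \<alpha> = \<beta> then 1 else 0)"
proof (cases "\<alpha> = \<beta>")
  case True
  have "fourier_coeff (\<lambda>z. monomial z \<alpha>) \<alpha> = (LINT z|torus. 1)"
    unfolding fourier_coeff_def
    by (intro Bochner_Integration.integral_cong) (auto simp: mult_cnj_unit norm_monomial)
  then show ?thesis using True by (simp add: torus.prob_space)
next
  case False
  then obtain k where k: "Poly_Mapping.lookup \<alpha> k \<noteq> Poly_Mapping.lookup \<beta> k"
    by (metis poly_mapping_eqI)
  define m n where "m = Poly_Mapping.lookup \<alpha> k" and "n = Poly_Mapping.lookup \<beta> k"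
  have mn: "m \<noteq> n" using k by (simp add: m_def n_def)
  \<comment> \<open>With this angle the two factors have ratio \<open>cis pi = -1\<close>, so the
    coefficient equals its own negative.\<close>
  define t where "t = pi / of_int (m - n)"
  define w where "w j = (if j = k then cis t else 1)" for j
  have w: "w \<in> space torus" by (auto simp: space_torus w_def)
  have mon: "monomial w \<gamma> = cis t powi Poly_Mapping.lookup \<gamma> k" for \<gamma>
  proof -
    have "monomial w \<gamma> = (\<Prod>j\<in>insert k (Poly_Mapping.keys \<gamma>). w j powi Poly_Mapping.lookup \<gamma> j)"
      by (rule monomial_superset) auto
    also have "\<dots> = (\<Prod>j\<in>{k}. w j powi Poly_Mapping.lookup \<gamma> j)"
      by (rule prod.mono_neutral_right) (auto simp: w_def)
    finally show ?thesis by (simp add: w_def)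
  qed
  let ?I = "fourier_coeff (\<lambda>z. monomial z \<alpha>) \<beta>"
  have "monomial w \<beta> * ?I = fourier_coeff (\<lambda>z. monomial (\<lambda>k. w k * z k) \<alpha>) \<beta>"
    by (rule fourier_coeff_translate[OF w, symmetric]) measurable
  also have "\<dots> = monomial w \<alpha> * ?I"
    by (simp add: monomial_mult fourier_coeff_def mult.assoc)
  finally have eq: "cis t powi n * ?I = cis t powi m * ?I"
    by (simp add: mon m_def n_def)
  have "cis t powi (m - n) = cis pi"
    using mn by (simp add: cis_power_int t_def)
  then have "cis t powi m = - (cis t powi n)"
    by (simp add: power_int_diff field_simps)
  with eq have "2 * (cis t powi n * ?I) = 0" by simp
  then have "?I = 0" by simp
  then show ?thesis using False by simp
qed

section \<open>Uniqueness of Fourier coefficients\<close>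

definition null_coeffs :: "((nat \<Rightarrow> complex) \<Rightarrow> complex) \<Rightarrow> bool" where
  "null_coeffs g \<longleftrightarrow> integrable torus g \<and> (\<forall>\<alpha>. fourier_coeff g \<alpha> = 0)"

text \<open>
  Multipliers form an algebra containing the coordinate and its conjugate, closed under bounded
  pointwise limits; by Stone--Weierstrass they contain the indicators of all Borel sets.
\<close>

definition multiplier :: "nat \<Rightarrow> (complex \<Rightarrow> complex) \<Rightarrow> bool" where
  "multiplier k h \<longleftrightarrow> (\<forall>g. null_coeffs g \<longrightarrow> null_coeffs (\<lambda>z. h (z k) * g z))"

lemma null_coeffs_add: "null_coeffs f \<Longrightarrow> null_coeffs g \<Longrightarrow> null_coeffs (\<lambda>z. f z + g z)"
  using integrable_mult_cnj_monomial[of f] integrable_mult_cnj_monomial[of g]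
  by (simp add: null_coeffs_def fourier_coeff_def distrib_right)

lemma null_coeffs_cmult: "null_coeffs g \<Longrightarrow> null_coeffs (\<lambda>z. c * g z)"
  by (auto simp: null_coeffs_def fourier_coeff_def mult.assoc)

lemma null_coeffs_cong:
  assumes "null_coeffs f" "\<And>z. z \<in> space torus \<Longrightarrow> f z = g z"
  shows "null_coeffs g"
proof -
  have "integrable torus f = integrable torus g"
    using assms(2) by (rule Bochner_Integration.integrable_cong[OF refl])
  moreover have "fourier_coeff f \<alpha> = fourier_coeff g \<alpha>" for \<alpha>
    unfolding fourier_coeff_def using assms(2) by (intro Bochner_Integration.integral_cong) auto
  ultimately show ?thesis using assms(1) by (simp add: null_coeffs_def)
qed

text \<open>The product shifts all coefficients by \<open>\<beta>\<close>. Since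
  \<open>null_coeffs\<close> demands vanishing at every integer index, it survives shifts in both
  directions.\<close>

lemma null_coeffs_mult_monomial:
  assumes "null_coeffs g"
  shows "null_coeffs (\<lambda>z. monomial z \<beta> * g z)"
proof -
  have "fourier_coeff (\<lambda>z. monomial z \<beta> * g z) \<alpha> = fourier_coeff g (\<alpha> - \<beta>)" for \<alpha>
    unfolding fourier_coeff_def
  proof (rule Bochner_Integration.integral_cong[OF refl])
    fix z assume z: "z \<in> space torus"
    have "monomial z \<alpha> = monomial z (\<alpha> - \<beta>) * monomial z \<beta>"
      using monomial_add[of z "\<alpha> - \<beta>" \<beta>] torus_coord_nonzero[OF z] by simp
    moreover have "monomial z \<beta> * cnj (monomial z \<beta>) = 1"
      using norm_monomial[OF z, of \<beta>] by (simp add: mult_cnj_unit)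
    ultimately show "monomial z \<beta> * g z * cnj (monomial z \<alpha>) = g z * cnj (monomial z (\<alpha> - \<beta>))"
      by (simp add: mult_ac)
  qed
  moreover have "integrable torus (\<lambda>z. monomial z \<beta> * g z)"
    using assms by (intro integrable_mult_bounded[where B = 1]) (auto simp: null_coeffs_def norm_monomial)
  ultimately show ?thesis using assms by (simp add: null_coeffs_def)
qed

lemma multiplier_add: "multiplier k f \<Longrightarrow> multiplier k g \<Longrightarrow> multiplier k (\<lambda>w. f w + g w)"
  unfolding multiplier_def distrib_right by (intro allI impI null_coeffs_add) blast+

lemma multiplier_mult:
  assumes "multiplier k f" "multiplier k g"
  shows "multiplier k (\<lambda>w. f w * g w)"
  unfolding multiplier_def
proof (intro allI impI)
  fix G assume "null_coeffs G"
  then have "null_coeffs (\<lambda>z. g (z k) * G z)" using assms(2) by (simp add: multiplier_def)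
  then have "null_coeffs (\<lambda>z. f (z k) * (g (z k) * G z))" using assms(1) unfolding multiplier_def by blast
  then show "null_coeffs (\<lambda>z. f (z k) * g (z k) * G z)" by (simp add: mult.assoc)
qed

lemma multiplier_const: "multiplier k (\<lambda>w. c)"
  by (simp add: multiplier_def null_coeffs_cmult)

lemma multiplier_id: "multiplier k (\<lambda>w. w)"
  using null_coeffs_mult_monomial[where \<beta> = "Poly_Mapping.single k 1"]
  by (simp add: multiplier_def monomial_single)

text \<open>On the unit circle conjugation is inversion, so this is again a shift, now by the
  exponent \<open>-1\<close> at \<open>k\<close>.\<close>

lemma multiplier_cnj: "multiplier k cnj"
  unfolding multiplier_def
proof (intro allI impI)
  fix G assume "null_coeffs G"
  then have "null_coeffs (\<lambda>z. monomial z (Poly_Mapping.single k (-1)) * G z)"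
    by (rule null_coeffs_mult_monomial)
  then show "null_coeffs (\<lambda>z. cnj (z k) * G z)"
  proof (rule null_coeffs_cong)
    fix z assume "z \<in> space torus"
    then have "norm (z k) = 1" by (rule norm_torus_coord)
    then have "inverse (z k) = cnj (z k)"
      by (intro inverse_unique) (simp add: mult_cnj_unit)
    then show "monomial z (Poly_Mapping.single k (-1)) * G z = cnj (z k) * G z"
      by (simp add: monomial_single power_int_minus)
  qed
qed

text \<open>Dominated convergence with majorant \<open>B * norm (G z)\<close>. Convergence and bound
  are asked for on the unit circle, where the coordinates of torus points lie.\<close>

lemma multiplier_lim:
  fixes h :: "nat \<Rightarrow> complex \<Rightarrow> complex"
  assumes h: "\<And>n. multiplier k (h n)"
    and lim: "\<And>w. norm w = 1 \<Longrightarrow> (\<lambda>n. h n w) \<longlonglongrightarrow> H w"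
    and meas: "\<And>n. h n \<in> borel_measurable borel" "H \<in> borel_measurable borel"
    and bound: "\<And>n w. norm w = 1 \<Longrightarrow> norm (h n w) \<le> B"
  shows "multiplier k H"
  unfolding multiplier_def
proof (intro allI impI)
  fix G assume G: "null_coeffs G"
  then have int: "integrable torus G" by (simp add: null_coeffs_def)
  note meas' = measurable_compose[OF measurable_torus_coord meas(1)]
    measurable_compose[OF measurable_torus_coord meas(2)]
  have HB: "norm (H w) \<le> B" if "norm w = 1" for w
    by (rule LIMSEQ_le_const2[OF tendsto_norm[OF lim[OF that]]]) (auto simp: bound that)
  have "(\<lambda>n. LINT z|torus. h n (z k) * G z * cnj (monomial z \<alpha>))
      \<longlonglongrightarrow> (LINT z|torus. H (z k) * G z * cnj (monomial z \<alpha>))" for \<alpha>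
  proof (rule integral_dominated_convergence[where w = "\<lambda>z. B * norm (G z)"])
    show "integrable torus (\<lambda>z. B * norm (G z))" using int by simp
    show "AE z in torus. (\<lambda>n. h n (z k) * G z * cnj (monomial z \<alpha>))
        \<longlonglongrightarrow> H (z k) * G z * cnj (monomial z \<alpha>)"
      by (intro AE_I2 tendsto_intros lim norm_torus_coord)
    show "AE z in torus. norm (h n (z k) * G z * cnj (monomial z \<alpha>)) \<le> B * norm (G z)" for n
      by (intro AE_I2)
        (simp add: norm_mult norm_monomial mult_right_mono bound norm_torus_coord)
    show "(\<lambda>z. H (z k) * G z * cnj (monomial z \<alpha>)) \<in> borel_measurable torus"
      "(\<lambda>z. h n (z k) * G z * cnj (monomial z \<alpha>)) \<in> borel_measurable torus" for n
      by (intro borel_measurable_times measurable_cnj_monomial meas'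
          borel_measurable_integrable[OF int])+
  qed
  moreover have "(LINT z|torus. h n (z k) * G z * cnj (monomial z \<alpha>)) = 0" for n \<alpha>
    using h[of n] G by (simp add: multiplier_def null_coeffs_def fourier_coeff_def)
  ultimately have "(LINT z|torus. H (z k) * G z * cnj (monomial z \<alpha>)) = 0" for \<alpha>
    using LIMSEQ_unique[OF tendsto_const] by fastforce
  moreover have "integrable torus (\<lambda>z. H (z k) * G z)"
    by (rule integrable_mult_bounded[OF int, of _ B]) (auto intro: HB meas' simp: norm_torus_coord)
  ultimately show "null_coeffs (\<lambda>z. H (z k) * G z)"
    by (simp add: null_coeffs_def fourier_coeff_def)
qed

lemma multiplier_real_polynomial_function:
  fixes p :: "complex \<Rightarrow> real"
  assumes "real_polynomial_function p"
  shows "multiplier k (\<lambda>w. of_real (p w))"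
  using assms
proof induction
  case (linear f)
  interpret bounded_linear f by fact
  \<comment> \<open>A real-linear map is \<open>f 1 * Re w + f \<i> * Im w\<close>; here
    \<open>Re w\<close> and \<open>Im w\<close> are written through \<open>w\<close> and
    \<open>cnj w\<close>.\<close>
  have "complex_of_real (f w) = (of_real (f 1) / 2 + of_real (f \<i>) * (- \<i> / 2)) * w
      + (of_real (f 1) / 2 - of_real (f \<i>) * (- \<i> / 2)) * cnj w" for w
  proof -
    have "w = Re w *\<^sub>R 1 + Im w *\<^sub>R \<i>" by (simp add: complex_eq_iff)
    then have "f w = Re w * f 1 + Im w * f \<i>" by (metis add scaleR real_scaleR_def)
    then show ?thesis by (simp add: complex_eq_iff algebra_simps)
  qed
  then have "(\<lambda>w. complex_of_real (f w)) = (\<lambda>w. (of_real (f 1) / 2 + of_real (f \<i>) * (- \<i> / 2)) * w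
      + (of_real (f 1) / 2 - of_real (f \<i>) * (- \<i> / 2)) * cnj w)" by (rule ext)
  then show ?case
    by (simp only:) (intro multiplier_add multiplier_mult multiplier_const multiplier_id multiplier_cnj)
next
  case (add f g)
  then show ?case by (simp add: multiplier_add)
next
  case (mult f g)
  then show ?case by (simp add: multiplier_mult)
qed (simp add: multiplier_const)

text \<open>Stone--Weierstrass on the compact unit circle supplies polynomials within
  \<open>inverse (Suc n)\<close> of \<open>f\<close>; being within \<open>1\<close> of
  \<open>f\<close>, they share the bound \<open>B + 1\<close>.\<close>

lemma multiplier_continuous:
  fixes f :: "complex \<Rightarrow> real"
  assumes f: "continuous_on UNIV f"
  shows "multiplier k (\<lambda>w. of_real (f w))"
proof -
  have cont: "continuous_on (sphere 0 1) f"
    using f by (rule continuous_on_subset) simp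
  have "\<exists>g. real_polynomial_function g \<and> (\<forall>w\<in>sphere 0 1. \<bar>f w - g w\<bar> < inverse (Suc n))" for n
    using Stone_Weierstrass_real_polynomial_function[OF compact_sphere cont, of "inverse (Suc n)"]
    by (metis inverse_positive_iff_positive of_nat_0_less_iff zero_less_Suc)
  then obtain g where g': "\<And>n. real_polynomial_function (g n) \<and>
      (\<forall>w\<in>sphere 0 1. \<bar>f w - g n w\<bar> < inverse (Suc n))"
    by metis
  then have g: "real_polynomial_function (g n)" for n by blast
  have close: "\<bar>f w - g n w\<bar> < inverse (Suc n)" if "norm w = 1" for n w
    using g'[of n] that by (metis mem_sphere_0)
  have "compact (f ` sphere 0 1)"
    using cont by (rule compact_continuous_image) simp
  then obtain B where "\<forall>x\<in>f ` sphere 0 1. norm x \<le> B"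
    using compact_imp_bounded bounded_iff by metis
  then have B: "\<bar>f w\<bar> \<le> B" if "norm w = 1" for w
    using that by simp
  show ?thesis
  proof (rule multiplier_lim[where h = "\<lambda>n w. of_real (g n w)" and B = "B + 1"])
    show "multiplier k (\<lambda>w. complex_of_real (g n w))" for n
      by (rule multiplier_real_polynomial_function[OF g])
    show "(\<lambda>w. complex_of_real (f w)) \<in> borel_measurable borel"
      using borel_measurable_continuous_onI[OF f] by measurable
    have "continuous_on UNIV (g n)" for n
      using g[of n] by (simp add: continuous_on_polymonial_function real_polynomial_function_eq)
    then show "(\<lambda>w. complex_of_real (g n w)) \<in> borel_measurable borel" for n
      using borel_measurable_continuous_onI[of "g n"] by measurable
  next
    fix w :: complex assume w: "norm w = 1"
    have "(\<lambda>n. f w - g n w) \<longlonglongrightarrow> 0"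
      by (rule tendsto_rabs_zero_cancel, rule tendsto_sandwich[OF _ _ tendsto_const LIMSEQ_inverse_real_of_nat])
        (auto intro!: always_eventually less_imp_le[OF close[OF w]] simp del: of_nat_Suc)
    from tendsto_diff[OF tendsto_const[of "f w"] this]
    show "(\<lambda>n. complex_of_real (g n w)) \<longlonglongrightarrow> complex_of_real (f w)"
      by (simp add: tendsto_of_real_iff)
    fix n
    have "inverse (real (Suc n)) \<le> 1" by (simp add: inverse_le_1_iff)
    then show "norm (complex_of_real (g n w)) \<le> B + 1"
      using close[OF w, of n] B[OF w] by simp
  qed
qed

lemma multiplier_closed:
  assumes A: "closed A"
  shows "multiplier k (indicator A)"
\<comment> \<open>By default \<open>infdist\<close> to the empty set is \<open>0\<close>, which
  would make the approximants below constantly \<open>1\<close>.\<close>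
proof (cases "A = {}")
  case True
  then show ?thesis using multiplier_const[of k 0] by (simp add: indicator_def[abs_def])
next
  case False
  \<comment> \<open>These continuous functions equal \<open>1\<close> on \<open>A\<close> and, as
    \<open>A\<close> is closed, are eventually \<open>0\<close> at each point outside it.\<close>
  define h where "h n w = max 0 (1 - real n * infdist w A)" for n and w :: complex
  show ?thesis
  proof (rule multiplier_lim[where h = "\<lambda>n w. of_real (h n w)" and B = 1])
    have c: "continuous_on UNIV (h n)" for n
      unfolding h_def by (intro continuous_intros)
    show "multiplier k (\<lambda>w. complex_of_real (h n w))" for n
      by (rule multiplier_continuous[OF c])
    show "(\<lambda>w. complex_of_real (h n w)) \<in> borel_measurable borel" for n
      using borel_measurable_continuous_onI[OF c, of n] by measurable
    show "indicator A \<in> borel_measurable borel"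
      using A by (intro borel_measurable_indicator borel_closed)
    show "norm (complex_of_real (h n w)) \<le> 1" for n w
      by (simp add: h_def infdist_nonneg)
    show "(\<lambda>n. complex_of_real (h n w)) \<longlonglongrightarrow> indicator A w" for w
    proof (cases "w \<in> A")
      case True
      then show ?thesis by (simp add: h_def)
    next
      case False
      then have pos: "infdist w A > 0"
        using A \<open>A \<noteq> {}\<close> by (metis in_closed_iff_infdist_zero infdist_nonneg less_eq_real_def)
      have "eventually (\<lambda>n. h n w = 0) sequentially"
      proof -
        obtain N where N: "1 / infdist w A < real N" using reals_Archimedean2 by blast
        have "h n w = 0" if "n \<ge> N" for n
        proof -
          have "1 / infdist w A \<le> real n" using N that by linarith
          then have "1 \<le> real n * infdist w A" using pos by (simp add: field_simps)
          then show ?thesis by (simp add: h_def)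
        qed
        then show ?thesis by (auto simp: eventually_sequentially)
      qed
      then show ?thesis
        using False by (intro tendsto_eventually) (auto elim: eventually_mono)
    qed
  qed
qed

text \<open>Dynkin's argument: the closed sets are stable under intersection and generate the Borel
  sets, complements are affine combinations, and disjoint unions are bounded limits of finite
  sums.\<close>

lemma multiplier_borel:
  assumes "A \<in> sets borel"
  shows "multiplier k (indicator A)"
proof -
  have "Int_stable (Collect closed)" "Collect closed \<subseteq> Pow (UNIV :: complex set)"
    by (auto simp: Int_stable_def)
  moreover have "A \<in> sigma_sets UNIV (Collect closed)"
    using assms unfolding borel_eq_closed by simp
  ultimately show ?thesis
  proof (induction A rule: sigma_sets_induct_disjoint)
    case (basic A)
    then show ?case by (simp add: multiplier_closed)
  next
    case empty
    then show ?case using multiplier_const[of k 0] by (simp add: indicator_def[abs_def])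
  next
    case (compl A)
    have "indicator (UNIV - A) = (\<lambda>w. (1::complex) + (-1) * indicator A w)"
      by (auto simp: indicator_def)
    then show ?case using compl
      by (simp only:) (intro multiplier_add multiplier_mult multiplier_const)
  next
    case (union A)
    have meas: "A i \<in> sets borel" for i
      using union.hyps(2) unfolding borel_eq_closed by auto
    have fin: "multiplier k (indicator (\<Union>i<n. A i))" for n
    proof (induction n)
      case 0
      then show ?case using multiplier_const[of k 0] by (simp add: indicator_def[abs_def])
    next
      case (Suc n)
      have "A i \<inter> A n = {}" if "i < n" for i
        using union.hyps(1) that by (auto simp: disjoint_family_on_def)
      then have "indicator (\<Union>i<Suc n. A i) = (\<lambda>w. indicator (\<Union>i<n. A i) w + indicator (A n) w :: complex)"
        by (fastforce simp: indicator_def less_Suc_eq)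
      then show ?case using Suc union.IH
        by (simp only:) (intro multiplier_add)
    qed
    show ?case
    proof (rule multiplier_lim[where h = "\<lambda>n. indicator (\<Union>i<n. A i)" and B = 1])
      show "(\<lambda>n. indicator (\<Union>i<n. A i) w :: complex) \<longlonglongrightarrow> indicator (\<Union>i. A i) w" for w
        by (rule LIMSEQ_indicator_UN)
    qed (use fin meas in \<open>auto simp: indicator_def\<close>)
  qed
qed

text \<open>It suffices that \<open>g\<close> integrates to \<open>0\<close> over every measurable
  set. The indicator of a cylinder is a finite product of one-coordinate multipliers, so there the
  integral is the coefficient at index \<open>0\<close> of a function with null coefficients.
  Dynkin's argument extends this from cylinders to the whole sigma-algebra.\<close>

lemma null_coeffs_imp_AE_zero:
  assumes g: "null_coeffs g"
  shows "AE z in torus. g z = 0"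
proof (rule torus.density_zero)
  show int: "integrable torus g" using g by (simp add: null_coeffs_def)
  let ?\<Omega> = "\<Pi>\<^sub>E k\<in>(UNIV::nat set). space circle"
  have sp: "space torus = ?\<Omega>" by (simp add: torus_def space_PiM)
  have sets: "sets torus = sigma_sets ?\<Omega> (prod_algebra UNIV (\<lambda>_. circle))"
    unfolding torus_def by (rule sets_PiM)
  fix A assume "A \<in> sets torus"
  then have "A \<in> sigma_sets ?\<Omega> (prod_algebra UNIV (\<lambda>_. circle))" by (simp add: sets)
  with Int_stable_prod_algebra prod_algebra_sets_into_space
  show "set_lebesgue_integral torus A g = 0"
  proof (induction rule: sigma_sets_induct_disjoint)
    case (basic A)
    then obtain J E where A: "A = prod_emb UNIV (\<lambda>_. circle) J (\<Pi>\<^sub>E j\<in>J. E j)"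
      and J: "finite J" and E: "\<And>j. j \<in> J \<Longrightarrow> E j \<in> sets circle"
      by (elim prod_algebraE) auto
    have "\<exists>F. F \<in> sets borel \<and> E j = F \<inter> sphere 0 1" if "j \<in> J" for j
      using E[OF that] by (auto simp: sets_circle sets_restrict_space)
    then obtain F where F: "\<And>j. j \<in> J \<Longrightarrow> F j \<in> sets borel" "\<And>j. j \<in> J \<Longrightarrow> E j = F j \<inter> sphere 0 1"
      by metis
    have "null_coeffs (\<lambda>z. (\<Prod>j\<in>J. indicator (F j) (z j)) * g z)"
      using J F(1)
    proof (induction J)
      case empty
      then show ?case using g by simp
    next
      case (insert i J)
      then have "null_coeffs (\<lambda>z. indicator (F i) (z i) * ((\<Prod>j\<in>J. indicator (F j) (z j)) * g z))"
        using multiplier_borel[of "F i" i] unfolding multiplier_def by blast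
      then show ?case using insert.hyps by (simp add: mult.assoc)
    qed
    then have "(LINT z|torus. (\<Prod>j\<in>J. indicator (F j) (z j)) * g z) = 0"
      unfolding null_coeffs_def fourier_coeff_def
      by (elim conjE allE[of _ 0]) simp
    moreover have "indicator A z *\<^sub>R g z = (\<Prod>j\<in>J. indicator (F j) (z j)) * g z"
      if z: "z \<in> space torus" for z
    proof -
      have "z \<in> A \<longleftrightarrow> (\<forall>j\<in>J. z j \<in> F j)"
        using z F(2) norm_torus_coord[OF z] by (auto simp: A prod_emb_def sp PiE_iff space_circle)
      moreover have "(\<Prod>j\<in>J. indicator (F j) (z j) :: complex) = (if \<forall>j\<in>J. z j \<in> F j then 1 else 0)"
        using J by (auto simp: indicator_def intro: prod.neutral)
      ultimately show ?thesis by simp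
    qed
    ultimately show ?case
      by (simp add: set_lebesgue_integral_def cong: Bochner_Integration.integral_cong)
  next
    case empty
    then show ?case by (simp add: set_lebesgue_integral_def)
  next
    case (compl A)
    have [measurable]: "A \<in> sets torus" using compl.hyps by (simp add: sets)
    have "(LINT z|torus. g z) = 0"
      using g unfolding null_coeffs_def fourier_coeff_def by (elim conjE allE[of _ 0]) simp
    moreover have "(LINT z|torus. g z) = set_lebesgue_integral torus (space torus) g"
      by (simp add: set_lebesgue_integral_def cong: Bochner_Integration.integral_cong)
    moreover have "space torus = A \<union> (?\<Omega> - A)"
      using sets.sets_into_space[of A torus] sp by auto
    moreover have "set_lebesgue_integral torus (A \<union> (?\<Omega> - A)) g
        = set_lebesgue_integral torus A g + set_lebesgue_integral torus (?\<Omega> - A) g"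
      unfolding sp[symmetric] using int
      by (intro set_integral_Un) (auto simp: set_integrable_def intro!: integrable_mult_indicator)
    ultimately show ?case using compl.IH by simp
  next
    case (union A)
    have "A i \<in> sets torus" for i using union.hyps by (auto simp: sets)
    then have "set_lebesgue_integral torus (\<Union>i. A i) g = suminf (\<lambda>i. set_lebesgue_integral torus (A i) g)"
      using union.hyps(1) int
      by (intro lebesgue_integral_countable_add)
        (auto simp: disjoint_family_on_def set_integrable_def intro!: integrable_mult_indicator)
    then show ?case using union.IH by simp
  qed
qed

lemma fourier_coeff_unique:
  assumes f: "integrable torus f" and g: "integrable torus g"
    and eq: "\<And>\<alpha>. fourier_coeff f \<alpha> = fourier_coeff g \<alpha>"
  shows "AE z in torus. f z = g z"
proof -
  have "null_coeffs (\<lambda>z. f z - g z)"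
    using f g eq by (auto simp: null_coeffs_def fourier_coeff_def left_diff_distrib integrable_mult_cnj_monomial)
  from null_coeffs_imp_AE_zero[OF this] show ?thesis by simp
qed

subsection \<open>Kernels on the line\<close>

text \<open>Computed from the antiderivative \<open>F\<close> on the half-line. The denominator is
  the one in \<open>ramp_kernel\<close>, which brings that kernel within reach of Levy
  inversion.\<close>

lemma char_exponential:
  assumes u: "u > 0"
  shows "char (density lborel (exponential_density u)) t = of_real u / (of_real u - \<i> * of_real t)"
proof -
  define s where "s = complex_of_real u - \<i> * of_real t"
  have Re_s: "Re s = u" by (simp add: s_def)
  then have s0: "s \<noteq> 0" using u by auto
  define f where "f x = of_real u * exp (- s * of_real x)" for x
  define F where "F x = - (of_real u / s) * exp (- s * of_real x)" for x
  have int: "integrable lborel (exponential_density u)"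
    using nn_integral_erlang_ith_moment[OF u, of 0 0] u
    by (intro integrableI_nonneg) (auto simp: exponential_density_nonneg)
  have "set_integrable lborel {0..} f"
    unfolding set_integrable_def
  proof (rule Bochner_Integration.integrable_bound[OF int])
    show "(\<lambda>x. indicator {0..} x *\<^sub>R f x) \<in> borel_measurable lborel"
      unfolding f_def by measurable
    show "AE x in lborel. norm (indicator {0..} x *\<^sub>R f x) \<le> norm (exponential_density u x)"
      using u by (intro AE_I2)
        (auto simp: f_def exponential_density_def norm_mult Re_s mult.commute indicator_def)
  qed
  then have si: "set_integrable lborel (einterval 0 \<infinity>) f"
    by (rule set_integrable_subset) (auto simp: einterval_def zero_ereal_def)
  have deriv: "(F has_vector_derivative f x) (at x)" for x
  proof -
    have "((\<lambda>z. - (of_real u / s) * exp (- s * z)) has_field_derivative f x) (at (of_real x))"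
      using s0 by (auto intro!: derivative_eq_intros simp: f_def)
    from has_vector_derivative_real_field[OF this] show ?thesis unfolding F_def[abs_def] .
  qed
  have "(LBINT x=0..\<infinity>. f x) = 0 - F 0"
  proof (rule interval_integral_FTC_integrable[OF _ deriv _ si])
    show "isCont f x" for x unfolding f_def by (intro continuous_intros)
    have "isCont F 0" unfolding F_def by (intro continuous_intros)
    then show "((F \<circ> real_of_ereal) \<longlongrightarrow> F 0) (at_right 0)"
      unfolding zero_ereal_def ereal_tendsto_simps1
      by (meson continuous_at_imp_continuous_within continuous_within)
    have "((\<lambda>x. norm (of_real u / s) * exp (- u * x)) \<longlongrightarrow> norm (of_real u / s) * 0) at_top"
      using u
      by (intro tendsto_intros filterlim_compose[OF exp_at_bot])
        (auto simp: filterlim_uminus_at_bot intro!: filterlim_tendsto_pos_mult_at_top[OF tendsto_const] filterlim_ident)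
    then have "(F \<longlongrightarrow> 0) at_top"
      by (intro tendsto_norm_zero_cancel[of F]) (simp add: F_def norm_mult norm_divide Re_s)
    then show "((F \<circ> real_of_ereal) \<longlongrightarrow> 0) (at_left \<infinity>)"
      by (simp add: ereal_tendsto_simps1)
  qed simp
  moreover have "(LBINT x=0..\<infinity>. f x) = (LINT x|lborel. indicator {0<..} x *\<^sub>R f x)"
    by (simp add: zero_ereal_def interval_integral_to_infinity_eq set_lebesgue_integral_def)
  \<comment> \<open>The half-line integral omits \<open>0\<close>, where the density equals
    \<open>u\<close>, so the integrands agree only almost everywhere.\<close>
  moreover have "(LINT x|lborel. indicator {0<..} x *\<^sub>R f x)
      = (LINT x|lborel. exponential_density u x *\<^sub>R exp (\<i> * of_real (t * x)))"
  proof (rule integral_cong_AE)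
    have eq: "exponential_density u x *\<^sub>R exp (\<i> * of_real (t * x)) = indicator {0<..} x *\<^sub>R f x"
      if "x \<noteq> 0" for x
    proof -
      have "exp (- complex_of_real x * u) * exp (\<i> * of_real (t * x)) = exp (- s * of_real x)"
        by (simp add: s_def algebra_simps flip: exp_add)
      then show ?thesis using that
        by (auto simp: exponential_density_def f_def scaleR_conv_of_real mult.assoc
            simp flip: exp_of_real)
    qed
    show "AE x in lborel. indicator {0<..} x *\<^sub>R f x
        = exponential_density u x *\<^sub>R exp (\<i> * of_real (t * x))"
      using AE_lborel_singleton[of 0] by eventually_elim (rule eq[symmetric])
  qed (simp_all add: f_def)
  moreover have "char (density lborel (exponential_density u)) t
      = (LINT x|lborel. exponential_density u x *\<^sub>R exp (\<i> * of_real (t * x)))"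
    unfolding char_def using u
    by (subst integral_density) (auto simp: exponential_density_nonneg)
  ultimately show ?thesis by (simp add: F_def s_def)
qed

text \<open>Input for Levy inversion, which needs endpoints without mass and returns the mass of an
  interval. The latter comes from the distribution function.\<close>

lemma
  fixes u :: real
  assumes u: "u > 0"
  defines "E \<equiv> density lborel (exponential_density u)"
  shows real_distribution_exponential: "real_distribution E"
    and measure_exponential_singleton: "measure E {a} = 0"
    and measure_exponential_Ioc: "a < b \<Longrightarrow>
      measure E {a<..b} = (if 0 \<le> b then 1 - exp (- u * b) else 0) - (if 0 \<le> a then 1 - exp (- u * a) else 0)"
proof -
  interpret prob_space E unfolding E_def by (rule prob_space_exponential_density[OF u])
  show rd: "real_distribution E" by unfold_locales (auto simp: E_def)
  interpret real_distribution E by fact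
  have "AE x in lborel. x \<in> {a} \<longrightarrow> ennreal (exponential_density u x) = 0"
    using AE_lborel_singleton[of a] by eventually_elim simp
  moreover have "(\<lambda>x. ennreal (exponential_density u x)) \<in> borel_measurable lborel" by simp
  ultimately have "{a} \<in> null_sets E"
    unfolding E_def by (subst null_sets_density_iff; simp only: sets_lborel borel_singleton[OF sets.empty_sets])
  then show "measure E {a} = 0" by (simp add: measure_eq_emeasure_eq_ennreal null_setsD1)
  have cdf: "cdf E x = (if 0 \<le> x then 1 - exp (- u * x) else 0)" for x
  proof -
    have "emeasure E {..x} = ennreal (if 0 \<le> x then 1 - exp (- u * x) else 0)"
      unfolding E_def emeasure_erlang_density[OF u] erlang_CDF_0 by simp
    then show ?thesis unfolding cdf_def using u by (intro measure_eq_emeasure_eq_ennreal) auto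
  qed
  show "measure E {a<..b} = (if 0 \<le> b then 1 - exp (- u * b) else 0) - (if 0 \<le> a then 1 - exp (- u * a) else 0)"
    if "a < b"
    using cdf_diff_eq[OF that] by (simp add: cdf)
qed

text \<open>
  The Fourier transform of \<open>ramp_kernel u c d\<close> at \<open>l\<close> is the mass that the exponential
  distribution with rate \<open>u\<close> gives to \<open>{l - d<..l - c}\<close>, scaled so that it equals \<open>exp (-u l)\<close> for \<open>l \<ge> d\<close>.
  The value at \<open>t = 0\<close> is the junk value \<open>0\<close>.
\<close>

definition ramp_kernel :: "real \<Rightarrow> real \<Rightarrow> real \<Rightarrow> real \<Rightarrow> complex" where
  "ramp_kernel u c d t = of_real (u / (2 * pi * (exp (u * d) - exp (u * c))))
     * ((iexp (t * d) - iexp (t * c)) / (\<i> * t) / (of_real u - \<i> * t))"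

text \<open>Neither \<open>c\<close> nor \<open>d\<close> occurs, so that one function can dominate
  the kernels for all \<open>N\<close>. For \<open>u > 0\<close> the exponent lies below
  \<open>-1\<close>, which makes the tails integrable.\<close>

definition ramp_majorant :: "real \<Rightarrow> real \<Rightarrow> real" where
  "ramp_majorant u t = (if \<bar>t\<bar> \<le> 1 then exp u / u else 3 * exp u * \<bar>t\<bar> powr (- 1 - min u 1))"

section \<open>An integrable bound for all ramp kernels\<close>

lemma measurable_ramp_kernel [measurable]: "ramp_kernel u c d \<in> borel_measurable borel"
  unfolding ramp_kernel_def by measurable

lemma measurable_ramp_majorant [measurable]: "ramp_majorant u \<in> borel_measurable borel"
  unfolding ramp_majorant_def by measurable

lemma ramp_majorant_nonneg: "u > 0 \<Longrightarrow> ramp_majorant u t \<ge> 0"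
  by (simp add: ramp_majorant_def)

lemma integrable_ramp_majorant:
  assumes u: "u > 0"
  shows "integrable lborel (ramp_majorant u)"
proof -
  define e where "e = - 1 - min u 1"
  define g where "g x = indicator {1..} x *\<^sub>R (x powr e)" for x :: real
  have "(\<lambda>x. x powr e) integrable_on {1..}"
    using has_integral_powr_to_inf[of e 1] u by (auto simp: e_def integrable_on_def)
  then have "(\<lambda>x. x powr e) absolutely_integrable_on {1..}"
    by (intro nonnegative_absolutely_integrable_1) auto
  then have g: "integrable lborel g"
    unfolding g_def set_integrable_def by (subst (asm) integrable_completion) auto
  then have g': "integrable lborel (\<lambda>x. g (- x))"
    using lborel_integrable_real_affine[OF g, of "-1" 0] by simp
  have "integrable lborel (\<lambda>x::real. indicator {-1..1} x *\<^sub>R (exp u / u))"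
    by (intro integrable_scaleR_left) auto
  with g g' have "integrable lborel (\<lambda>x. indicator {-1..1} x *\<^sub>R (exp u / u) + 3 * exp u * (g x + g (- x)))"
    by simp
  then show ?thesis
  proof (rule Bochner_Integration.integrable_bound)
    have "exp u / u > 0" "exp u / u + 3 * exp u > 0"
      using u by (simp_all add: add_pos_pos)
    then show "AE x in lborel. norm (ramp_majorant u x)
        \<le> norm (indicator {-1..1} x *\<^sub>R (exp u / u) + 3 * exp u * (g x + g (- x)))"
      by (intro AE_I2) (auto simp: ramp_majorant_def g_def indicator_def e_def abs_if)
  qed simp
qed

text \<open>The difference quotient of the exponentials is at most \<open>d - c\<close> and at most
  \<open>2 / \<bar>t\<bar>\<close>. Multiplied by the normalising factor \<open>A\<close>, this
  gives \<open>exp (- u * c) * min 1 y\<close>. Hypothesis \<open>h\<close> limits the steepness of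
  the ramp, so interpolating the minimum costs at most a power of \<open>exp c\<close> that the
  decay in \<open>c\<close> can pay for.\<close>

lemma norm_ramp_kernel_le:
  assumes u: "u > 0" and c: "-1 \<le> c" and cd: "c < d" and h: "1 / (d - c) \<le> 3 * exp c"
  shows "norm (ramp_kernel u c d t) \<le> ramp_majorant u t"
proof (cases "t = 0")
  case True
  then show ?thesis using u by (simp add: ramp_kernel_def ramp_majorant_def)
next
  case False
  define A where "A = u / (2 * pi * (exp (u * d) - exp (u * c)))"
  define r where "r = norm ((iexp (t * d) - iexp (t * c)) / (\<i> * t))"
  have r1: "r \<le> d - c"
    unfolding r_def using Levy_Inversion_aux2[of c d t] cd False by simp
  have r2: "r \<le> 2 / \<bar>t\<bar>"
  proof -
    have "norm (iexp (t * d) - iexp (t * c)) \<le> 2"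
      using norm_triangle_ineq4[of "iexp (t * d)" "iexp (t * c)"] by simp
    then show ?thesis
      unfolding r_def norm_divide norm_mult by (simp add: divide_right_mono)
  qed
  have r0: "r \<ge> 0" by (simp add: r_def)
  have pos: "exp (u * d) - exp (u * c) > 0" using u cd by simp
  then have A0: "A \<ge> 0" using u by (simp add: A_def)
  have norm_eq: "norm (ramp_kernel u c d t) = A * r / norm (of_real u - \<i> * of_real t)"
  proof -
    have "ramp_kernel u c d t
        = of_real A * ((iexp (t * d) - iexp (t * c)) / (\<i> * t) / (of_real u - \<i> * t))"
      by (simp only: ramp_kernel_def A_def)
    then show ?thesis
      using A0 by (simp only: norm_mult norm_divide[of _ "of_real u - \<i> * of_real t"] norm_of_real r_def) simp
  qed
  have den: "u \<le> norm (of_real u - \<i> * of_real t)" "\<bar>t\<bar> \<le> norm (of_real u - \<i> * of_real t)"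
    using abs_Re_le_cmod[of "of_real u - \<i> * of_real t"] abs_Im_le_cmod[of "of_real u - \<i> * of_real t"] u
    by auto
  \<comment> \<open>The inequality \<open>exp x - 1 \<ge> x\<close> bounds the normalising
    difference from below by \<open>exp (u * c) * (u * (d - c))\<close>.\<close>
  have A1: "A \<le> exp (- u * c) / (2 * (d - c))"
  proof -
    have "u * (d - c) \<le> exp (u * (d - c)) - 1"
      using exp_ge_add_one_self[of "u * (d - c)"] by linarith
    then have "exp (u * c) * (u * (d - c)) \<le> exp (u * c) * (exp (u * (d - c)) - 1)"
      by simp
    also have "\<dots> = exp (u * d) - exp (u * c)"
      by (simp add: algebra_simps flip: exp_add)
    finally have 1: "exp (u * c) * (u * (d - c)) \<le> exp (u * d) - exp (u * c)" .
    have "2 * (exp (u * c) * (u * (d - c))) \<le> 2 * pi * (exp (u * d) - exp (u * c))"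
      using pi_ge_two u cd by (intro mult_mono[OF _ 1]) auto
    then have "A \<le> u / (2 * (exp (u * c) * (u * (d - c))))"
      unfolding A_def using u cd pos by (intro divide_left_mono) auto
    also have "\<dots> = exp (- u * c) / (2 * (d - c))"
    proof -
      have "u / (2 * (e * (u * h))) = inverse e / (2 * h)" for e h
        using u by (simp add: divide_simps)
      then show ?thesis by (simp add: exp_minus)
    qed
    finally show ?thesis .
  qed
  have Ar: "A * r \<le> exp (- u * c)"
  proof -
    have "A * r \<le> exp (- u * c) / (2 * (d - c)) * (d - c)"
      using A1 r1 r0 cd by (intro mult_mono) auto
    also have "\<dots> = exp (- u * c) / 2"
    proof -
      have "x / (2 * h) * h = x / 2" if "h \<noteq> 0" for x h :: real using that by simp
      then show ?thesis using cd by (metis diff_gt_0_iff_gt less_irrefl)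
    qed
    finally show ?thesis by (rule order_trans) simp
  qed
  show ?thesis
  proof (cases "\<bar>t\<bar> \<le> 1")
    case True
    note Ar
    also have "- u * c \<le> u" using u c mult_left_mono[of "-1" c u] by simp
    then have "exp (- u * c) \<le> exp u" by simp
    finally have "A * r / norm (of_real u - \<i> * of_real t) \<le> exp u / u"
      using den u by (intro frac_le) auto
    then show ?thesis using True by (simp add: norm_eq ramp_majorant_def)
  next
    case t: False
    \<comment> \<open>Interpolation exponent: \<open>\<theta> \<le> 1\<close> allows
      \<open>min 1 y \<le> y powr \<theta>\<close>, and \<open>\<theta> \<le> u\<close> lets
      \<open>exp (- u * c)\<close> absorb the factor \<open>exp (\<theta> * c)\<close> caused by the
      steepness.\<close>
    define \<theta> where "\<theta> = min u 1"
    have \<theta>: "0 < \<theta>" "\<theta> \<le> 1" "\<theta> \<le> u" using u by (auto simp: \<theta>_def)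
    define y where "y = 1 / ((d - c) * \<bar>t\<bar>)"
    have y: "y > 0" using cd t by (simp add: y_def)
    have "A * r \<le> exp (- u * c) * min 1 y"
    proof -
      have "A * r \<le> exp (- u * c) / (2 * (d - c)) * (2 / \<bar>t\<bar>)"
        using A1 r2 r0 cd by (intro mult_mono) auto
      also have "\<dots> = exp (- u * c) * y"
      proof -
        have "x / (2 * h) * (2 / a) = x * (1 / (h * a))" for x h a :: real by simp
        then show ?thesis unfolding y_def .
      qed
      finally show ?thesis using Ar by (auto simp: min_def)
    qed
    also have "min 1 y \<le> y powr \<theta>"
    proof (cases "y \<le> 1")
      case True
      then have "y powr 1 \<le> y powr \<theta>" using y \<theta> by (intro powr_mono') auto
      then show ?thesis using y True by simp
    next
      case False
      then show ?thesis using \<theta> by (simp add: ge_one_powr_ge_zero)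
    qed
    also have "y powr \<theta> = (1 / (d - c)) powr \<theta> * \<bar>t\<bar> powr (- \<theta>)"
    proof -
      have "(1 / (h * a)) powr \<theta> = (1 / h) powr \<theta> * a powr (- \<theta>)" if "h > 0" "a > 0" for h a :: real
        using that by (simp add: powr_divide powr_mult powr_minus field_simps)
      then show ?thesis using cd t by (simp add: y_def)
    qed
    also have "(1 / (d - c)) powr \<theta> \<le> (3 * exp c) powr \<theta>"
      using h cd \<theta> by (intro powr_mono2) auto
    also have "\<dots> = 3 powr \<theta> * exp (\<theta> * c)"
      unfolding powr_mult by (simp add: powr_def)
    also have "3 powr \<theta> \<le> (3::real) powr 1"
      using \<theta> by (intro powr_mono) auto
    finally have "A * r \<le> 3 * (exp (- u * c) * exp (\<theta> * c)) * \<bar>t\<bar> powr (- \<theta>)"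
      by (simp add: mult_ac mult_left_mono mult_right_mono)
    also have "exp (- u * c) * exp (\<theta> * c) = exp (- ((u - \<theta>) * c))"
      by (simp add: algebra_simps flip: exp_add)
    \<comment> \<open>From \<open>-1 \<le> c\<close> and
      \<open>0 \<le> u - \<theta> \<le> u\<close>; here the dependence on \<open>c\<close>
      disappears.\<close>
    also have "- ((u - \<theta>) * c) \<le> u"
      using mult_left_mono[OF c, of "u - \<theta>"] \<theta> by simp
    finally have 2: "A * r \<le> 3 * exp u * \<bar>t\<bar> powr (- \<theta>)"
      by (simp add: mult_left_mono mult_right_mono)
    have "norm (ramp_kernel u c d t) \<le> A * r / \<bar>t\<bar>"
      unfolding norm_eq using den A0 r0 t by (intro frac_le) auto
    also have "\<dots> \<le> 3 * exp u * \<bar>t\<bar> powr (- \<theta>) / \<bar>t\<bar>"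
      using 2 by (rule divide_right_mono) simp
    also have "\<dots> = 3 * exp u * \<bar>t\<bar> powr (- 1 - \<theta>)"
      using t by (simp add: powr_diff powr_minus field_simps)
    finally show ?thesis using t by (simp add: ramp_majorant_def \<theta>_def)
  qed
qed

text \<open>Levy inversion for the exponential distribution with endpoints \<open>l - d\<close> and
  \<open>l - c\<close>. For \<open>l \<le> c\<close> the interval contains no positive number and
  has mass \<open>0\<close>; for \<open>d \<le> l\<close> its mass is \<open>exp (- u * l)\<close>
  times the normalising difference \<open>D\<close>.\<close>

lemma ramp_kernel_fourier:
  assumes u: "u > 0" and c: "-1 \<le> c" and cd: "c < d" and h: "1 / (d - c) \<le> 3 * exp c"
    and l: "l \<le> c \<or> d \<le> l"
  shows "(LINT t|lborel. ramp_kernel u c d t * iexp (- (t * l))) = of_real (if l \<le> c then 0 else exp (- u * l))"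
proof -
  define E where "E = density lborel (exponential_density u)"
  interpret real_distribution E
    unfolding E_def by (rule real_distribution_exponential[OF u])
  let ?f = "\<lambda>t. ramp_kernel u c d t * iexp (- (t * l))"
  let ?g = "\<lambda>t. (iexp (- (t * (l - d))) - iexp (- (t * (l - c)))) / (\<i> * t) * char E t"
  define D where "D = exp (u * d) - exp (u * c)"
  have D: "D > 0" using u cd by (simp add: D_def)
  have bound: "norm (?f t) \<le> ramp_majorant u t" for t
    using norm_ramp_kernel_le[OF u c cd h, of t] by (simp add: norm_mult)
  have fg: "?f t = of_real (1 / D) * (1 / (2 * pi) * ?g t)" for t
  proof -
    have "(iexp (t * d) - iexp (t * c)) * iexp (- (t * l)) = iexp (- (t * (l - d))) - iexp (- (t * (l - c)))"
      by (simp add: algebra_simps flip: exp_add)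
    moreover have "?f t = of_real (u / (2 * pi * D))
        * ((iexp (t * d) - iexp (t * c)) * iexp (- (t * l)) / (\<i> * t) / (of_real u - \<i> * t))"
      by (simp add: ramp_kernel_def D_def)
    ultimately show ?thesis
      by (simp add: char_exponential[OF u] E_def mult_ac)
  qed
  have int: "integrable lborel ?f"
    by (rule Bochner_Integration.integrable_bound[OF integrable_ramp_majorant[OF u]])
      (use bound ramp_majorant_nonneg[OF u] in auto)
  \<comment> \<open>Levy inversion yields only a limit over symmetric intervals; domination
    identifies it with the integral over the line.\<close>
  have "(\<lambda>n. LINT t|lborel. indicator {- real n..real n} t *\<^sub>R ?f t) \<longlonglongrightarrow> (LINT t|lborel. ?f t)"
  proof (rule integral_dominated_convergence[OF _ _ integrable_ramp_majorant[OF u]])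
    show "AE t in lborel. (\<lambda>n. indicator {- real n..real n} t *\<^sub>R ?f t) \<longlonglongrightarrow> ?f t"
    proof (intro AE_I2 tendsto_eventually)
      fix t :: real
      obtain N where N: "\<bar>t\<bar> \<le> real N" using real_arch_simple by blast
      have "indicator {- real n..real n} t *\<^sub>R ?f t = ?f t" if "n \<ge> N" for n
      proof -
        have "t \<in> {- real n..real n}" using N that by auto
        then show ?thesis by simp
      qed
      then show "\<forall>\<^sub>F n in sequentially. indicator {- real n..real n} t *\<^sub>R ?f t = ?f t"
        unfolding eventually_sequentially by blast
    qed
    show "AE t in lborel. norm (indicator {- real n..real n} t *\<^sub>R ?f t) \<le> ramp_majorant u t" for n
      using bound ramp_majorant_nonneg[OF u] by (intro AE_I2) (auto simp: indicator_def)
  qed auto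
  moreover have "(LINT t|lborel. indicator {- real n..real n} t *\<^sub>R ?f t)
      = of_real (1 / D) * (1 / (2 * pi) * (CLBINT t=- real n..real n. ?g t))" for n
  proof -
    have "(LINT t|lborel. indicator {- real n..real n} t *\<^sub>R ?f t) = (CLBINT t=- real n..real n. ?f t)"
      by (simp add: interval_integral_Icc set_lebesgue_integral_def)
    also have "\<dots> = of_real (1 / D) * (1 / (2 * pi) * (CLBINT t=- real n..real n. ?g t))"
      unfolding fg by (simp only: interval_lebesgue_integral_mult_right)
    finally show ?thesis .
  qed
  moreover have "(\<lambda>n. 1 / (2 * pi) * (CLBINT t=- real n..real n. ?g t)) \<longlonglongrightarrow> of_real (measure E {l - d<..l - c})"
    using Levy_Inversion[of "l - d" "l - c"] cd by (simp add: E_def measure_exponential_singleton[OF u])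
  then have "(\<lambda>n. of_real (1 / D) * (1 / (2 * pi) * (CLBINT t=- real n..real n. ?g t)))
      \<longlonglongrightarrow> of_real (1 / D) * of_real (measure E {l - d<..l - c})"
    by (intro tendsto_mult tendsto_const)
  ultimately have "(LINT t|lborel. ?f t) = of_real (measure E {l - d<..l - c} / D)"
    using LIMSEQ_unique by fastforce
  moreover have "measure E {l - d<..l - c} / D = (if l \<le> c then 0 else exp (- u * l))"
  proof -
    have m: "measure E {l - d<..l - c} = (if 0 \<le> l - c then 1 - exp (- u * (l - c)) else 0)
        - (if 0 \<le> l - d then 1 - exp (- u * (l - d)) else 0)"
      unfolding E_def using cd by (intro measure_exponential_Ioc[OF u]) auto
    show ?thesis
    proof (cases "l \<le> c")
      case True
      then show ?thesis using cd by (auto simp: m)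
    next
      case False
      then have "measure E {l - d<..l - c} = exp (- u * (l - d)) - exp (- u * (l - c))"
        using l cd by (simp add: m)
      also have "\<dots> = exp (- u * l) * D"
        by (simp add: D_def algebra_simps flip: exp_add)
      finally show ?thesis using False D by simp
    qed
  qed
  ultimately show ?thesis by simp
qed

subsection \<open>Averaging along the Kronecker flow\<close>

definition flow :: "real \<Rightarrow> nat \<Rightarrow> complex" where
  "flow t k = cis (- t * ln (real (nth_prime k)))"

text \<open>For \<open>l \<ge> 0\<close> the first ramp has transform \<open>exp (- u * l)\<close>.
  The second ramp cancels it from \<open>ln (N + 1)\<close> onwards and contributes \<open>0\<close>
  up to \<open>ln N\<close>.\<close>

definition cutoff_kernel :: "real \<Rightarrow> nat \<Rightarrow> real \<Rightarrow> complex" where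
  "cutoff_kernel u N t = ramp_kernel u (- 1) 0 t - ramp_kernel u (ln (real N)) (ln (real N + 1)) t"

lemma measurable_cutoff_kernel [measurable]: "cutoff_kernel u N \<in> borel_measurable borel"
  unfolding cutoff_kernel_def by measurable

text \<open>By \<open>ln y \<le> y - 1\<close> at \<open>y = N / (N + 1)\<close> the gap between the
  logarithms is at least \<open>1 / (N + 1)\<close>, and \<open>N + 1 \<le> 3 * N\<close>.\<close>

lemma ln_ramp_slope:
  assumes "N \<ge> 1"
  shows "1 / (ln (real N + 1) - ln (real N)) \<le> 3 * exp (ln (real N))"
proof -
  have N: "real N \<ge> 1" using assms by simp
  have "ln (real N / (real N + 1)) \<le> real N / (real N + 1) - 1"
    using N by (intro ln_le_minus_one) auto
  also have "\<dots> = - (1 / (real N + 1))" using N by (simp add: field_simps)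
  finally have "1 / (real N + 1) \<le> ln (real N + 1) - ln (real N)"
    using N by (simp add: ln_div)
  then have "1 / (ln (real N + 1) - ln (real N)) \<le> 1 / (1 / (real N + 1))"
    using N by (intro divide_left_mono) auto
  also have "\<dots> \<le> 3 * exp (ln (real N))" using N by simp
  finally show ?thesis .
qed

text \<open>The source of the constant \<open>3\<close>: for \<open>c = -1\<close> and
  \<open>d = 0\<close> the steepness condition reads \<open>exp 1 \<le> 3\<close>.\<close>

lemma initial_ramp_slope: "1 / (0 - (- 1)) \<le> 3 * exp (- 1 :: real)"
  using exp_le by (simp add: exp_minus field_simps)

lemma norm_cutoff_kernel_le:
  assumes u: "u > 0" and N: "N \<ge> 1"
  shows "norm (cutoff_kernel u N t) \<le> 2 * ramp_majorant u t"
proof -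
  have "norm (ramp_kernel u (- 1) 0 t) \<le> ramp_majorant u t"
    by (rule norm_ramp_kernel_le[OF u _ _ initial_ramp_slope]) auto
  moreover have "norm (ramp_kernel u (ln (real N)) (ln (real N + 1)) t) \<le> ramp_majorant u t"
    using N order_trans[OF _ ln_ge_zero[of "real N"], of "- 1"]
    by (intro norm_ramp_kernel_le[OF u _ _ ln_ramp_slope[OF N]]) simp_all
  ultimately show ?thesis
    unfolding cutoff_kernel_def by (intro order_trans[OF norm_triangle_ineq4]) linarith
qed

lemma integrable_cutoff_kernel:
  assumes u: "u > 0" and N: "N \<ge> 1"
  shows "integrable lborel (cutoff_kernel u N)"
proof (rule Bochner_Integration.integrable_bound)
  show "integrable lborel (\<lambda>t. 2 * ramp_majorant u t)"
    using integrable_ramp_majorant[OF u] by simp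
  show "AE t in lborel. norm (cutoff_kernel u N t) \<le> norm (2 * ramp_majorant u t)"
    using norm_cutoff_kernel_le[OF u N] ramp_majorant_nonneg[OF u] by simp
qed simp

lemma cutoff_kernel_fourier:
  assumes u: "u > 0" and N: "N \<ge> 1" and n: "n \<ge> 1"
  shows "(LINT t|lborel. cutoff_kernel u N t * cis (- t * ln (real n)))
    = (if n \<le> N then of_real (real n powr - u) else 0)"
proof -
  let ?l = "ln (real n)"
  have l: "?l \<ge> 0" using n by simp
  have N0: "ln (real N) \<ge> 0" using N by simp
  \<comment> \<open>Integrality of \<open>n\<close> keeps \<open>ln n\<close> out of the interior of
    the ramp, where \<open>ramp_kernel_fourier\<close> says nothing.\<close>
  have alt: "?l \<le> ln (real N) \<or> ln (real N + 1) \<le> ?l"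
    using n N by (cases "n \<le> N") auto
  have cd: "ln (real N) < ln (real N + 1)" using N by simp
  have int: "integrable lborel (\<lambda>t. ramp_kernel u c d t * iexp (- (t * ?l)))"
    if "- 1 \<le> c" "c < d" "1 / (d - c) \<le> 3 * exp c" for c d
  proof (rule Bochner_Integration.integrable_bound[OF integrable_ramp_majorant[OF u]])
    show "AE t in lborel. norm (ramp_kernel u c d t * iexp (- (t * ?l))) \<le> norm (ramp_majorant u t)"
      using norm_ramp_kernel_le[OF u that] ramp_majorant_nonneg[OF u] by (simp add: norm_mult)
  qed simp
  have 1: "(LINT t|lborel. ramp_kernel u (- 1) 0 t * iexp (- (t * ?l))) = of_real (exp (- u * ?l))"
    using ramp_kernel_fourier[OF u _ _ initial_ramp_slope, of ?l] l by simp
  have 2: "(LINT t|lborel. ramp_kernel u (ln (real N)) (ln (real N + 1)) t * iexp (- (t * ?l)))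
      = of_real (if ?l \<le> ln (real N) then 0 else exp (- u * ?l))"
    using N0 by (intro ramp_kernel_fourier[OF u _ cd ln_ramp_slope[OF N] alt]) simp
  have "(LINT t|lborel. cutoff_kernel u N t * cis (- t * ?l))
      = (LINT t|lborel. ramp_kernel u (- 1) 0 t * iexp (- (t * ?l))
          - ramp_kernel u (ln (real N)) (ln (real N + 1)) t * iexp (- (t * ?l)))"
    by (simp add: cutoff_kernel_def cis_conv_exp left_diff_distrib)
  also have "\<dots> = of_real (exp (- u * ?l)) - of_real (if ?l \<le> ln (real N) then 0 else exp (- u * ?l))"
    using N0 cd initial_ramp_slope ln_ramp_slope[OF N] unfolding 1[symmetric] 2[symmetric]
    by (intro Bochner_Integration.integral_diff int) auto
  also have "\<dots> = (if n \<le> N then of_real (real n powr - u) else 0)"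
    using n N by (simp add: powr_def)
  finally show ?thesis .
qed

lemma flow_in_torus: "flow t \<in> space torus"
  by (auto simp: space_torus flow_def)

text \<open>The logarithm turns the product over primes into the sum of the angles. Rotation along
  the flow thus acts on a coefficient through \<open>ln (prime_power \<alpha>)\<close>
  alone.\<close>

lemma monomial_flow: "monomial (flow t) \<alpha> = cis (- t * ln (prime_power \<alpha>))"
proof -
  have p: "real (nth_prime k) > 0" for k
    using prime_gt_0_nat[OF prime_nth_prime] by simp
  have "finite S \<Longrightarrow> (\<Prod>k\<in>S. flow t k powi e k) = cis (- t * ln (\<Prod>k\<in>S. real (nth_prime k) powi e k))"
    for S and e :: "nat \<Rightarrow> int"
  proof (induction S rule: finite_induct)
    case (insert k S)
    have pos: "real (nth_prime k) powi e k > 0" "(\<Prod>k\<in>S. real (nth_prime k) powi e k) > 0"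
      using p by (auto intro!: prod_pos zero_less_power_int)
    have "ln (real (nth_prime k) powi e k) = of_int (e k) * ln (real (nth_prime k))"
      using p[of k] by (simp add: ln_powr flip: powr_real_of_int')
    with insert pos show ?case
      by (simp add: ln_mult_pos flow_def cis_power_int cis_mult algebra_simps)
  qed simp
  then show ?thesis by (simp add: monomial_def prime_power_def)
qed

lemma prime_power_nat:
  assumes "\<alpha> \<in> nonneg_indices"
  obtains n where "n \<ge> 1" "prime_power \<alpha> = real n"
proof
  let ?n = "\<Prod>k\<in>Poly_Mapping.keys \<alpha>. nth_prime k ^ nat (Poly_Mapping.lookup \<alpha> k)"
  show "prime_power \<alpha> = real ?n"
    using assms by (simp add: prime_power_def monomial_def power_int_def nonneg_indices_def)
  have "?n > 0" using prime_gt_0_nat[OF prime_nth_prime] by (intro prod_pos) simp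
  then show "?n \<ge> 1" by linarith
qed

text \<open>Joint measurability in time and torus point, for the exchanges of integrals
  below.\<close>

lemma measurable_flow:
  "(\<lambda>(t, z) k. flow t k * z k) \<in> lborel \<Otimes>\<^sub>M torus \<rightarrow>\<^sub>M torus"
proof (rule measurable_into_torus)
  fix k
  have [measurable]: "(\<lambda>t. flow t k) \<in> borel_measurable borel"
    unfolding flow_def
    by (intro borel_measurable_continuous_onI continuous_intros)
  show "(\<lambda>x. (case x of (t, z) \<Rightarrow> \<lambda>k. flow t k * z k) k) \<in> borel_measurable (lborel \<Otimes>\<^sub>M torus)"
    by (simp add: case_prod_beta)
next
  fix x :: "real \<times> (nat \<Rightarrow> complex)"
  assume "x \<in> space (lborel \<Otimes>\<^sub>M torus)"
  then show "(case x of (t, z) \<Rightarrow> \<lambda>k. flow t k * z k) \<in> space torus"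
    using flow_in_torus by (auto simp: space_pair_measure space_torus norm_mult Pi_iff)
qed

section \<open>Convolution along the flow\<close>

interpretation line_torus: pair_sigma_finite lborel torus ..

lemma measurable_flow_compose:
  assumes "f \<in> borel_measurable torus"
  shows "(\<lambda>(t, z). f (\<lambda>k. flow t k * z k)) \<in> borel_measurable (lborel \<Otimes>\<^sub>M torus)"
  using measurable_compose[OF measurable_flow assms] by (simp add: case_prod_beta)

definition flow_conv ::
  "(real \<Rightarrow> complex) \<Rightarrow> ((nat \<Rightarrow> complex) \<Rightarrow> complex) \<Rightarrow> (nat \<Rightarrow> complex) \<Rightarrow> complex" where
  "flow_conv K f z = (LINT t|lborel. K t * f (\<lambda>k. flow t k * z k))"

text \<open>Tonelli reduces the claim to one rotation at a time, and each rotation preserves the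
  norm of \<open>f\<close>.\<close>

lemma nn_integral_flow_conv:
  assumes f: "integrable torus f" and K: "integrable lborel (K :: real \<Rightarrow> real)" "\<And>t. K t \<ge> 0"
  shows "(\<integral>\<^sup>+z. (\<integral>\<^sup>+t. ennreal (K t * norm (f (\<lambda>k. flow t k * z k))) \<partial>lborel) \<partial>torus)
    = ennreal ((LINT t|lborel. K t) * L1_norm f)"
proof -
  note fm = borel_measurable_integrable[OF f] and Km = borel_measurable_integrable[OF K(1)]
  have "(\<integral>\<^sup>+z. (\<integral>\<^sup>+t. ennreal (K t * norm (f (\<lambda>k. flow t k * z k))) \<partial>lborel) \<partial>torus)
      = (\<integral>\<^sup>+t. (\<integral>\<^sup>+z. ennreal (K t * norm (f (\<lambda>k. flow t k * z k))) \<partial>torus) \<partial>lborel)"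
  proof (rule line_torus.Fubini')
    have "(\<lambda>x. ennreal (K (fst x) * norm (case x of (t, z) \<Rightarrow> f (\<lambda>k. flow t k * z k))))
        \<in> borel_measurable (lborel \<Otimes>\<^sub>M torus)"
      by (intro measurable_compose[OF _ measurable_ennreal] borel_measurable_times
          measurable_compose[OF measurable_flow_compose[OF fm] borel_measurable_norm] measurable_compose[OF measurable_fst Km])
    then show "(\<lambda>(t, z). ennreal (K t * norm (f (\<lambda>k. flow t k * z k)))) \<in> borel_measurable (lborel \<Otimes>\<^sub>M torus)"
      by (simp only: case_prod_beta')
  qed
  also have "\<dots> = (\<integral>\<^sup>+t. ennreal (K t) * ennreal (L1_norm f) \<partial>lborel)"
  proof (rule nn_integral_cong)
    fix t :: real
    have mt: "(\<lambda>z. f (\<lambda>k. flow t k * z k)) \<in> borel_measurable torus"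
      by (rule measurable_compose[OF torus_translate_measurable[OF flow_in_torus] fm])
    have "(\<integral>\<^sup>+z. ennreal (K t * norm (f (\<lambda>k. flow t k * z k))) \<partial>torus)
        = ennreal (K t) * (\<integral>\<^sup>+z. ennreal (norm (f (\<lambda>k. flow t k * z k))) \<partial>torus)"
      using mt K(2) by (simp add: ennreal_mult nn_integral_cmult)
    also have "(\<integral>\<^sup>+z. ennreal (norm (f (\<lambda>k. flow t k * z k))) \<partial>torus) = (\<integral>\<^sup>+z. ennreal (norm (f z)) \<partial>torus)"
      using fm by (intro torus_translate_nn_integral[OF flow_in_torus]) simp
    also have "\<dots> = ennreal (L1_norm f)"
      unfolding L1_norm_def using f by (intro nn_integral_eq_integral) auto
    finally show "(\<integral>\<^sup>+z. ennreal (K t * norm (f (\<lambda>k. flow t k * z k))) \<partial>torus) = ennreal (K t) * ennreal (L1_norm f)" .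
  qed
  also have "\<dots> = (\<integral>\<^sup>+t. ennreal (K t) \<partial>lborel) * ennreal (L1_norm f)"
    using Km by (intro nn_integral_multc) simp
  also have "(\<integral>\<^sup>+t. ennreal (K t) \<partial>lborel) = ennreal (LINT t|lborel. K t)"
    using K by (intro nn_integral_eq_integral) auto
  finally show ?thesis
    using K by (simp add: ennreal_mult L1_norm_def)
qed

lemma integrable_flow_pair:
  assumes f: "integrable torus f" and K: "integrable lborel (K :: real \<Rightarrow> complex)"
  shows "integrable (lborel \<Otimes>\<^sub>M torus) (\<lambda>(t, z). K t * f (\<lambda>k. flow t k * z k))"
proof (rule integrableI_bounded)
  have "(\<lambda>x. K (fst x) * (case x of (t, z) \<Rightarrow> f (\<lambda>k. flow t k * z k)))
      \<in> borel_measurable (lborel \<Otimes>\<^sub>M torus)"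
    using f K by (intro borel_measurable_times measurable_flow_compose measurable_compose[OF measurable_fst]
        borel_measurable_integrable)
  then show m: "(\<lambda>(t, z). K t * f (\<lambda>k. flow t k * z k)) \<in> borel_measurable (lborel \<Otimes>\<^sub>M torus)"
    by (simp only: case_prod_beta')
  then have m': "(\<lambda>x. ennreal (norm (case x of (t, z) \<Rightarrow> K t * f (\<lambda>k. flow t k * z k))))
      \<in> borel_measurable (lborel \<Otimes>\<^sub>M torus)" by measurable
  have "(\<integral>\<^sup>+x. ennreal (norm (case x of (t, z) \<Rightarrow> K t * f (\<lambda>k. flow t k * z k))) \<partial>(lborel \<Otimes>\<^sub>M torus))
      = (\<integral>\<^sup>+z. (\<integral>\<^sup>+t. ennreal (norm (K t) * norm (f (\<lambda>k. flow t k * z k))) \<partial>lborel) \<partial>torus)"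
    by (subst line_torus.nn_integral_snd[OF m', symmetric]) (simp add: norm_mult)
  also have "\<dots> < \<infinity>"
    using K by (subst nn_integral_flow_conv[OF f]) auto
  finally show "(\<integral>\<^sup>+x. ennreal (norm (case x of (t, z) \<Rightarrow> K t * f (\<lambda>k. flow t k * z k))) \<partial>(lborel \<Otimes>\<^sub>M torus)) < \<infinity>" .
qed

lemma integrable_flow_conv:
  assumes "integrable torus f" "integrable lborel K"
  shows "integrable torus (flow_conv K f)"
  unfolding flow_conv_def[abs_def]
  using line_torus.integrable_snd[OF integrable_flow_pair[OF assms]] .

text \<open>Fubini moves the coefficient inside the integral over \<open>t\<close>, where
  \<open>fourier_coeff_translate\<close> and \<open>monomial_flow\<close> turn the rotation into a
  scalar factor.\<close>

lemma fourier_coeff_flow_conv: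
  assumes f: "integrable torus f" and K: "integrable lborel K"
  shows "fourier_coeff (flow_conv K f) \<alpha>
    = (LINT t|lborel. K t * cis (- t * ln (prime_power \<alpha>))) * fourier_coeff f \<alpha>"
proof -
  have "integrable (lborel \<Otimes>\<^sub>M torus)
      (\<lambda>x. cnj (monomial (snd x) \<alpha>) * (case x of (t, z) \<Rightarrow> K t * f (\<lambda>k. flow t k * z k)))"
  proof (rule integrable_mult_bounded[OF integrable_flow_pair[OF f K]])
    show "(\<lambda>x. cnj (monomial (snd x) \<alpha>)) \<in> borel_measurable (lborel \<Otimes>\<^sub>M torus)"
      by (rule measurable_compose[OF measurable_snd measurable_cnj_monomial])
    show "norm (cnj (monomial (snd x) \<alpha>)) \<le> 1" if "x \<in> space (lborel \<Otimes>\<^sub>M torus)" for x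
      using that by (auto simp: space_pair_measure norm_monomial)
  qed
  then have int: "integrable (lborel \<Otimes>\<^sub>M torus)
      (\<lambda>(t, z). K t * f (\<lambda>k. flow t k * z k) * cnj (monomial z \<alpha>))"
    by (simp add: case_prod_beta' mult_ac)
  have "fourier_coeff (flow_conv K f) \<alpha>
      = (LINT z|torus. (LINT t|lborel. K t * f (\<lambda>k. flow t k * z k) * cnj (monomial z \<alpha>)))"
    by (simp add: fourier_coeff_def flow_conv_def)
  also have "\<dots> = (LINT t|lborel. (LINT z|torus. K t * f (\<lambda>k. flow t k * z k) * cnj (monomial z \<alpha>)))"
    by (rule line_torus.Fubini_integral[OF int])
  also have "\<dots> = (LINT t|lborel. K t * fourier_coeff (\<lambda>z. f (\<lambda>k. flow t k * z k)) \<alpha>)"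
    by (simp add: fourier_coeff_def mult.assoc)
  also have "\<dots> = (LINT t|lborel. K t * cis (- t * ln (prime_power \<alpha>)) * fourier_coeff f \<alpha>)"
    using f by (simp add: fourier_coeff_translate[OF flow_in_torus] monomial_flow mult.assoc)
  finally show ?thesis by simp
qed

section \<open>Partial sums as convolutions, and their maximal function\<close>

lemma fourier_coeff_trig_polynomial:
  assumes "finite A"
  shows "fourier_coeff (\<lambda>z. \<Sum>\<alpha>\<in>A. c \<alpha> * monomial z \<alpha>) \<beta> = (if \<beta> \<in> A then c \<beta> else 0)"
proof -
  have "fourier_coeff (\<lambda>z. \<Sum>\<alpha>\<in>A. c \<alpha> * monomial z \<alpha>) \<beta>
      = (LINT z|torus. (\<Sum>\<alpha>\<in>A. c \<alpha> * (monomial z \<alpha> * cnj (monomial z \<beta>))))"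
    by (simp add: fourier_coeff_def sum_distrib_right mult.assoc)
  also have "\<dots> = (\<Sum>\<alpha>\<in>A. c \<alpha> * fourier_coeff (\<lambda>z. monomial z \<alpha>) \<beta>)"
    unfolding fourier_coeff_def
    by (subst Bochner_Integration.integral_sum)
      (auto intro!: integrable_mult_cnj_monomial integrable_monomial)
  also have "\<dots> = (if \<beta> \<in> A then c \<beta> else 0)"
    using assms by (simp add: fourier_coeff_monomial if_distrib[of "(*) _"] sum.delta cong: if_cong)
  finally show ?thesis .
qed

text \<open>Both sides have the same Fourier coefficients. Outside \<open>nonneg_indices\<close> the
  value \<open>prime_power \<alpha>\<close> can be a fraction whose logarithm falls inside a ramp;
  there the Hardy condition makes both coefficients vanish. On \<open>nonneg_indices\<close> it is a
  positive integer and \<open>cutoff_kernel_fourier\<close> applies.\<close>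

lemma partial_sum_AE:
  assumes u: "u > 0" and N: "N \<ge> 1" and f: "f \<in> hardy_H1"
  shows "AE z in torus. flow_conv (cutoff_kernel u N) f z
    = (\<Sum>\<alpha> | \<alpha> \<in> nonneg_indices \<and> prime_power \<alpha> < real N + 1.
        fourier_coeff f \<alpha> / complex_of_real (prime_power \<alpha> powr u) * monomial z \<alpha>)"
proof (rule fourier_coeff_unique)
  have int: "integrable torus f" using f by (simp add: hardy_H1_def)
  show "integrable torus (flow_conv (cutoff_kernel u N) f)"
    by (rule integrable_flow_conv[OF int integrable_cutoff_kernel[OF u N]])
  show "integrable torus (\<lambda>z. \<Sum>\<alpha> | \<alpha> \<in> nonneg_indices \<and> prime_power \<alpha> < real N + 1.
        fourier_coeff f \<alpha> / complex_of_real (prime_power \<alpha> powr u) * monomial z \<alpha>)"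
    by (intro Bochner_Integration.integrable_sum integrable_mult_right integrable_monomial)
  fix \<alpha>
  have S: "fourier_coeff (\<lambda>z. \<Sum>\<alpha> | \<alpha> \<in> nonneg_indices \<and> prime_power \<alpha> < real N + 1.
        fourier_coeff f \<alpha> / complex_of_real (prime_power \<alpha> powr u) * monomial z \<alpha>) \<alpha>
      = (if \<alpha> \<in> {\<alpha> \<in> nonneg_indices. prime_power \<alpha> < real N + 1}
         then fourier_coeff f \<alpha> / complex_of_real (prime_power \<alpha> powr u) else 0)"
    by (rule fourier_coeff_trig_polynomial[OF finite_prime_power_less])
  show "fourier_coeff (flow_conv (cutoff_kernel u N) f) \<alpha>
    = fourier_coeff (\<lambda>z. \<Sum>\<alpha> | \<alpha> \<in> nonneg_indices \<and> prime_power \<alpha> < real N + 1.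
        fourier_coeff f \<alpha> / complex_of_real (prime_power \<alpha> powr u) * monomial z \<alpha>) \<alpha>"
  proof (cases "\<alpha> \<in> nonneg_indices")
    case False
    then have "fourier_coeff f \<alpha> = 0" using f by (simp add: hardy_H1_def)
    then show ?thesis
      unfolding S by (simp add: fourier_coeff_flow_conv[OF int integrable_cutoff_kernel[OF u N]])
  next
    case True
    then obtain n where n: "n \<ge> 1" "prime_power \<alpha> = real n" by (rule prime_power_nat)
    have "real n < real N + 1 \<longleftrightarrow> n \<le> N" by linarith
    then show ?thesis using True
      unfolding S by (simp add: fourier_coeff_flow_conv[OF int integrable_cutoff_kernel[OF u N]]
          n cutoff_kernel_fourier[OF u N n(1), simplified]
          powr_minus divide_inverse mult.commute)
  qed
qed

text \<open>Holds at every point \<open>z\<close>, with a right-hand side free of \<open>N\<close>,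
  so it passes to the supremum over \<open>N\<close>.\<close>

lemma norm_flow_conv_cutoff_le:
  assumes u: "u > 0" and N: "N \<ge> 1"
  shows "ennreal (norm (flow_conv (cutoff_kernel u N) f z))
    \<le> (\<integral>\<^sup>+t. ennreal (2 * ramp_majorant u t * norm (f (\<lambda>k. flow t k * z k))) \<partial>lborel)"
proof (cases "integrable lborel (\<lambda>t. cutoff_kernel u N t * f (\<lambda>k. flow t k * z k))")
  case True
  have "ennreal (norm (flow_conv (cutoff_kernel u N) f z))
      \<le> (\<integral>\<^sup>+t. ennreal (norm (cutoff_kernel u N t * f (\<lambda>k. flow t k * z k))) \<partial>lborel)"
    unfolding flow_conv_def by (rule integral_norm_bound_ennreal[OF True])
  also have "\<dots> \<le> (\<integral>\<^sup>+t. ennreal (2 * ramp_majorant u t * norm (f (\<lambda>k. flow t k * z k))) \<partial>lborel)"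
    by (intro nn_integral_mono ennreal_leI)
      (simp only: norm_mult, intro mult_right_mono norm_cutoff_kernel_le[OF u N] norm_ge_zero)
  finally show ?thesis .
next
  \<comment> \<open>The Bochner integral of a non-integrable function is \<open>0\<close> by
    default, so the bound is trivial.\<close>
  case False
  then show ?thesis by (simp add: flow_conv_def not_integrable_integral_eq)
qed

lemma partial_sum_maximal:
  assumes u: "u > 0" and f: "f \<in> hardy_H1"
  shows "(\<integral>\<^sup>+z. (SUP x\<in>{0::real<..}.
      ennreal (norm (\<Sum>\<alpha> | \<alpha> \<in> nonneg_indices \<and> prime_power \<alpha> < x.
        fourier_coeff f \<alpha> / complex_of_real (prime_power \<alpha> powr u) * monomial z \<alpha>))) \<partial>torus)
    \<le> ennreal (2 * (LINT t|lborel. ramp_majorant u t) * L1_norm f)"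
proof -
  let ?S = "\<lambda>x z. \<Sum>\<alpha> | \<alpha> \<in> nonneg_indices \<and> prime_power \<alpha> < x.
        fourier_coeff f \<alpha> / complex_of_real (prime_power \<alpha> powr u) * monomial z \<alpha>"
  let ?G = "\<lambda>z. \<integral>\<^sup>+t. ennreal (2 * ramp_majorant u t * norm (f (\<lambda>k. flow t k * z k))) \<partial>lborel"
  have int: "integrable torus f" using f by (simp add: hardy_H1_def)
  \<comment> \<open>There are countably many \<open>N\<close>, so one null set serves for all of
    them.\<close>
  have "AE z in torus. \<forall>N\<in>{1..}. flow_conv (cutoff_kernel u N) f z = ?S (real N + 1) z"
    by (subst AE_ball_countable) (simp, intro ballI partial_sum_AE[OF u _ f], simp)
  then have "AE z in torus. (SUP x\<in>{0::real<..}. ennreal (norm (?S x z))) \<le> ?G z"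
  proof eventually_elim
    fix z assume eq: "\<forall>N\<in>{1..}. flow_conv (cutoff_kernel u N) f z = ?S (real N + 1) z"
    show "(SUP x\<in>{0::real<..}. ennreal (norm (?S x z))) \<le> ?G z"
    proof (rule SUP_least)
      fix x :: real assume "x \<in> {0<..}"
      then have x: "x > 0" by simp
      \<comment> \<open>The largest integer below \<open>x\<close>. As the values of
        \<open>prime_power\<close> in question are integers, the cutoffs at \<open>x\<close> and at
        \<open>N + 1\<close> select the same indices.\<close>
      define N where "N = nat (\<lceil>x\<rceil> - 1)"
      have "int N = \<lceil>x\<rceil> - 1" using x by (simp add: N_def)
      then have "real n < x \<longleftrightarrow> real n < real N + 1" for n :: nat
        using less_ceiling_iff[of "int n" x] by linarith
      then have same: "{\<alpha> \<in> nonneg_indices. prime_power \<alpha> < x} = {\<alpha> \<in> nonneg_indices. prime_power \<alpha> < real N + 1}"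
        by (intro Collect_cong conj_cong refl) (metis prime_power_nat)
      show "ennreal (norm (?S x z)) \<le> ?G z"
      proof (cases "N \<ge> 1")
        case True
        then show ?thesis
          unfolding same using eq norm_flow_conv_cutoff_le[OF u True, of f z] by simp
      next
        \<comment> \<open>Here \<open>N = 0\<close>, that is \<open>x \<le> 1\<close>, and the sum
          is empty.\<close>
        case False
        then have empty: "{\<alpha> \<in> nonneg_indices. prime_power \<alpha> < real N + 1} = {}"
          by (auto elim!: prime_power_nat)
        show ?thesis unfolding same empty by simp
      qed
    qed
  qed
  then have "(\<integral>\<^sup>+z. (SUP x\<in>{0::real<..}. ennreal (norm (?S x z))) \<partial>torus) \<le> (\<integral>\<^sup>+z. ?G z \<partial>torus)"
    by (rule nn_integral_mono_AE)
  also have "\<dots> = ennreal ((LINT t|lborel. 2 * ramp_majorant u t) * L1_norm f)"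
    using integrable_ramp_majorant[OF u] ramp_majorant_nonneg[OF u]
    by (intro nn_integral_flow_conv[OF int]) auto
  finally show ?thesis by simp
qed

subsection \<open>Dirichlet series\<close>

lemma Xi_eq_monomial:
  assumes \<xi>: "\<xi> \<in> Xi" and \<alpha>: "\<alpha> \<in> nonneg_indices" and n: "real n = prime_power \<alpha>"
  shows "\<xi> n = monomial (prime_values \<xi>) \<alpha>"
proof -
  have mult: "\<xi> (m * n) = \<xi> m * \<xi> n" if "m \<ge> 1" "n \<ge> 1" for m n
    using \<xi> that by (simp add: Xi_def)
  have one: "\<xi> (Suc 0) = 1" using Xi_one[OF \<xi>] by simp
  have p: "nth_prime k \<ge> 1" for k
    using prime_gt_0_nat[OF prime_nth_prime, of k] by simp
  have pow: "\<xi> (nth_prime k ^ e) = \<xi> (nth_prime k) ^ e" for k e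
    by (induction e) (use p[of k] in \<open>auto simp: one mult Suc_le_eq\<close>)
  have prod: "finite S \<Longrightarrow> \<xi> (\<Prod>k\<in>S. nth_prime k ^ e k) = (\<Prod>k\<in>S. \<xi> (nth_prime k) ^ e k)" for S e
  proof (induction S rule: finite_induct)
    case (insert k S)
    have "nth_prime k ^ e k > 0" "(\<Prod>k\<in>S. nth_prime k ^ e k) > 0"
      using prime_gt_0_nat[OF prime_nth_prime] by (auto intro!: prod_pos)
    then have "\<xi> (nth_prime k ^ e k * (\<Prod>k\<in>S. nth_prime k ^ e k))
        = \<xi> (nth_prime k ^ e k) * \<xi> (\<Prod>k\<in>S. nth_prime k ^ e k)"
      by (intro mult) linarith+
    with insert show ?case by (simp add: pow)
  qed (simp add: one)
  have "real n = real (\<Prod>k\<in>Poly_Mapping.keys \<alpha>. nth_prime k ^ nat (Poly_Mapping.lookup \<alpha> k))"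
    using \<alpha> n by (simp add: prime_power_def monomial_def power_int_def nonneg_indices_def)
  then have "n = (\<Prod>k\<in>Poly_Mapping.keys \<alpha>. nth_prime k ^ nat (Poly_Mapping.lookup \<alpha> k))"
    by (simp only: of_nat_eq_iff)
  then show ?thesis
    using \<alpha> by (simp add: prod monomial_def prime_values_def power_int_def nonneg_indices_def)
qed

text \<open>
  Unique factorisation comes from the characters: monomials with the same \<open>\<pp>\<^sup>\<alpha>\<close> agree on the torus,
  and distinct monomials are orthogonal.
\<close>

lemma inj_on_prime_power: "inj_on prime_power nonneg_indices"
proof (rule inj_onI)
  fix \<alpha> \<beta> assume \<alpha>: "\<alpha> \<in> nonneg_indices" and \<beta>: "\<beta> \<in> nonneg_indices" and eq: "prime_power \<alpha> = prime_power \<beta>"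
  obtain n where n: "prime_power \<alpha> = real n" using prime_power_nat[OF \<alpha>] by metis
  have "monomial z \<alpha> = monomial z \<beta>" if "z \<in> space torus" for z
  proof -
    obtain \<xi> where "\<xi> \<in> Xi" "z = prime_values \<xi>"
      using bij_prime_values \<open>z \<in> space torus\<close> by (auto simp: bij_betw_def)
    then show ?thesis
      using Xi_eq_monomial[of \<xi> \<alpha> n] Xi_eq_monomial[of \<xi> \<beta> n] \<alpha> \<beta> eq n by simp
  qed
  then have "fourier_coeff (\<lambda>z. monomial z \<alpha>) \<beta> = fourier_coeff (\<lambda>z. monomial z \<beta>) \<beta>"
    unfolding fourier_coeff_def by (intro Bochner_Integration.integral_cong) auto
  then show "\<alpha> = \<beta>" by (simp add: fourier_coeff_monomial split: if_splits)
qed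

lemma ex_prime_power:
  assumes "n \<ge> 1"
  shows "\<exists>\<alpha>\<in>nonneg_indices. prime_power \<alpha> = real n"
  using assms
proof (induction n rule: prime_divisors_induct)
  case (unit n)
  then show ?case
    by (intro bexI[of _ 0]) (auto simp: prime_power_def nonneg_indices_def)
next
  case (factor p n)
  then obtain \<alpha> where \<alpha>: "\<alpha> \<in> nonneg_indices" "prime_power \<alpha> = real n"
    by (auto simp: Suc_le_eq)
  have "p \<in> range nth_prime"
    using factor by (simp add: bij_betw_imp_surj_on[OF bij_nth_prime])
  then obtain k where k: "p = nth_prime k" by blast
  have nz: "real (nth_prime k) \<noteq> 0" for k
    using prime_gt_0_nat[OF prime_nth_prime, of k] by simp
  have "prime_power (Poly_Mapping.single k 1 + \<alpha>) = real (p * n)"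
    using \<alpha> nz by (simp add: prime_power_def monomial_add monomial_single k)
  moreover have "Poly_Mapping.single k 1 + \<alpha> \<in> nonneg_indices"
    using \<alpha> by (simp add: nonneg_indices_def lookup_add lookup_single when_def)
  ultimately show ?case by blast
qed simp

text \<open>On nonnegative indices \<open>prime_power\<close> is a positive integer, so the floor
  merely changes the type. The strict bound by \<open>x + 1\<close> matches the closed range
  \<open>{1..x}\<close>.\<close>

lemma bij_betw_prime_power:
  "bij_betw (\<lambda>\<alpha>. nat \<lfloor>prime_power \<alpha>\<rfloor>) {\<alpha> \<in> nonneg_indices. prime_power \<alpha> < real x + 1} {1..x}"
proof (rule bij_betw_imageI)
  have nat: "prime_power \<alpha> = real (nat \<lfloor>prime_power \<alpha>\<rfloor>)" if "\<alpha> \<in> nonneg_indices" for \<alpha>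
    using prime_power_nat[OF that] by (metis floor_of_nat nat_int)
  show "inj_on (\<lambda>\<alpha>. nat \<lfloor>prime_power \<alpha>\<rfloor>) {\<alpha> \<in> nonneg_indices. prime_power \<alpha> < real x + 1}"
  proof (rule inj_onI)
    fix \<alpha> \<beta>
    assume \<alpha>: "\<alpha> \<in> {\<alpha> \<in> nonneg_indices. prime_power \<alpha> < real x + 1}"
      and \<beta>: "\<beta> \<in> {\<alpha> \<in> nonneg_indices. prime_power \<alpha> < real x + 1}"
      and eq: "nat \<lfloor>prime_power \<alpha>\<rfloor> = nat \<lfloor>prime_power \<beta>\<rfloor>"
    have "prime_power \<alpha> = real (nat \<lfloor>prime_power \<beta>\<rfloor>)"
      using nat[of \<alpha>] \<alpha> unfolding eq by blast
    also have "\<dots> = prime_power \<beta>"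
      using nat[of \<beta>] \<beta> by simp
    finally show "\<alpha> = \<beta>"
      using \<alpha> \<beta> by (intro inj_onD[OF inj_on_prime_power]) simp_all
  qed
  show "(\<lambda>\<alpha>. nat \<lfloor>prime_power \<alpha>\<rfloor>) ` {\<alpha> \<in> nonneg_indices. prime_power \<alpha> < real x + 1} = {1..x}"
  proof (intro equalityI subsetI)
    fix n assume "n \<in> (\<lambda>\<alpha>. nat \<lfloor>prime_power \<alpha>\<rfloor>) ` {\<alpha> \<in> nonneg_indices. prime_power \<alpha> < real x + 1}"
    then show "n \<in> {1..x}" by (auto elim!: prime_power_nat)
  next
    fix n assume n: "n \<in> {1..x}"
    then obtain \<alpha> where "\<alpha> \<in> nonneg_indices" "prime_power \<alpha> = real n"
      using ex_prime_power[of n] by auto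
    with n show "n \<in> (\<lambda>\<alpha>. nat \<lfloor>prime_power \<alpha>\<rfloor>) ` {\<alpha> \<in> nonneg_indices. prime_power \<alpha> < real x + 1}"
      by (intro image_eqI[of _ _ \<alpha>]) auto
  qed
qed

section \<open>Transfer from the torus to \<open>Xi\<close>\<close>

lemma dirichlet_partial_sum:
  assumes a: "bohr_lift a f" and \<xi>: "\<xi> \<in> Xi"
  shows "(\<Sum>n=1..x. a n / complex_of_real (real n powr u) * \<xi> n)
    = (\<Sum>\<alpha> | \<alpha> \<in> nonneg_indices \<and> prime_power \<alpha> < real x + 1.
        fourier_coeff f \<alpha> / complex_of_real (prime_power \<alpha> powr u) * monomial (prime_values \<xi>) \<alpha>)"
proof (subst sum.reindex_bij_betw[OF bij_betw_prime_power, symmetric], rule sum.cong[OF refl])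
  fix \<alpha> assume "\<alpha> \<in> {\<alpha> \<in> nonneg_indices. prime_power \<alpha> < real x + 1}"
  then have \<alpha>: "\<alpha> \<in> nonneg_indices" by simp
  then obtain n where n: "prime_power \<alpha> = real n" by (rule prime_power_nat)
  have "a n = fourier_coeff f \<alpha>" using a \<alpha> n by (simp add: bohr_lift_def)
  moreover have "\<xi> n = monomial (prime_values \<xi>) \<alpha>" using Xi_eq_monomial[OF \<xi> \<alpha>] n by simp
  ultimately show "a (nat \<lfloor>prime_power \<alpha>\<rfloor>) / complex_of_real (real (nat \<lfloor>prime_power \<alpha>\<rfloor>) powr u) * \<xi> (nat \<lfloor>prime_power \<alpha>\<rfloor>)
      = fourier_coeff f \<alpha> / complex_of_real (prime_power \<alpha> powr u) * monomial (prime_values \<xi>) \<alpha>"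
    by (simp add: n)
qed

text \<open>\<open>Xi_haar\<close> is the image of \<open>torus\<close> under the inverse of
  \<open>prime_values\<close>, so in the change of variables the two maps cancel.\<close>

lemma nn_integral_Xi_haar:
  assumes "h \<in> borel_measurable torus"
  shows "(\<integral>\<^sup>+\<xi>. h (prime_values \<xi>) \<partial>Xi_haar) = (\<integral>\<^sup>+z. h z \<partial>torus)"
proof -
  have "prime_values \<in> vimage_algebra Xi prime_values torus \<rightarrow>\<^sub>M torus"
    using bij_prime_values by (intro measurable_vimage_algebra1) (auto simp: bij_betw_def)
  then have "(\<lambda>\<xi>. h (prime_values \<xi>)) \<in> borel_measurable (vimage_algebra Xi prime_values torus)"
    using assms by (rule measurable_compose)
  then have "(\<integral>\<^sup>+\<xi>. h (prime_values \<xi>) \<partial>Xi_haar)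
      = (\<integral>\<^sup>+z. h (prime_values (the_inv_into Xi prime_values z)) \<partial>torus)"
    unfolding Xi_haar_def by (intro nn_integral_distr[OF measurable_the_inv_prime_values]) simp
  also have "\<dots> = (\<integral>\<^sup>+z. h z \<partial>torus)"
    by (intro nn_integral_cong) (simp add: f_the_inv_into_f_bij_betw[OF bij_prime_values])
  finally show ?thesis .
qed

theorem theorem3p2:
  fixes u :: real
  assumes "u > 0"
  shows "\<exists>C>0.
    (\<forall>a\<in>dirichlet_H1.
      (\<integral>\<^sup>+\<xi>. (SUP x\<in>{1::nat..}.
          ennreal (norm (\<Sum>n=1..x. a n / complex_of_real (real n powr u) * \<xi> n))) \<partial>Xi_haar)
      \<le> ennreal (C * dirichlet_H1_norm a)) \<and>
    (\<forall>f\<in>hardy_H1.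
      (\<integral>\<^sup>+z. (SUP x\<in>{0::real<..}.
          ennreal (norm (\<Sum>\<alpha> | \<alpha> \<in> nonneg_indices \<and> prime_power \<alpha> < x.
            fourier_coeff f \<alpha> / complex_of_real (prime_power \<alpha> powr u) * monomial z \<alpha>))) \<partial>torus)
      \<le> ennreal (C * L1_norm f))"
proof -
  \<comment> \<open>The summand \<open>1\<close> secures \<open>C > 0\<close> from mere
    nonnegativity of the integral.\<close>
  define C where "C = 2 * (LINT t|lborel. ramp_majorant u t) + 1"
  have "(LINT t|lborel. ramp_majorant u t) \<ge> 0"
    by (rule Bochner_Integration.integral_nonneg) (rule ramp_majorant_nonneg[OF assms])
  then have C: "C > 0" by (simp add: C_def)
  have torus: "(\<integral>\<^sup>+z. (SUP x\<in>{0::real<..}.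
          ennreal (norm (\<Sum>\<alpha> | \<alpha> \<in> nonneg_indices \<and> prime_power \<alpha> < x.
            fourier_coeff f \<alpha> / complex_of_real (prime_power \<alpha> powr u) * monomial z \<alpha>))) \<partial>torus)
      \<le> ennreal (C * L1_norm f)" if f: "f \<in> hardy_H1" for f
  proof -
    have "2 * (LINT t|lborel. ramp_majorant u t) * L1_norm f \<le> C * L1_norm f"
      by (rule mult_right_mono) (simp_all add: C_def L1_norm_def)
    with partial_sum_maximal[OF assms f] show ?thesis
      by (rule order_trans[OF _ ennreal_leI])
  qed
  have "(\<integral>\<^sup>+\<xi>. (SUP x\<in>{1::nat..}.
          ennreal (norm (\<Sum>n=1..x. a n / complex_of_real (real n powr u) * \<xi> n))) \<partial>Xi_haar)
      \<le> ennreal (C * dirichlet_H1_norm a)" if a: "a \<in> dirichlet_H1" for a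
  proof -
    \<comment> \<open>The same choice as in \<open>dirichlet_H1_norm\<close>, so its
      \<open>L1_norm\<close> is the norm of \<open>a\<close> by definition.\<close>
    define f where "f = (SOME f. bohr_lift a f)"
    have lift: "bohr_lift a f"
      using a unfolding f_def dirichlet_H1_def mem_Collect_eq by (rule someI_ex)
    let ?S = "\<lambda>x z. \<Sum>\<alpha> | \<alpha> \<in> nonneg_indices \<and> prime_power \<alpha> < x.
            fourier_coeff f \<alpha> / complex_of_real (prime_power \<alpha> powr u) * monomial z \<alpha>"
    define h where "h z = (SUP x\<in>{1::nat..}. ennreal (norm (?S (real x + 1) z)))" for z
    \<comment> \<open>The transfer to \<open>Xi_haar\<close> requires measurability, which a
      supremum over countably many cutoffs preserves.\<close>
    have h: "h \<in> borel_measurable torus"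
      unfolding h_def
      by (intro borel_measurable_SUP measurable_compose[OF _ measurable_ennreal]
          measurable_compose[OF _ borel_measurable_norm] borel_measurable_sum borel_measurable_times
          borel_measurable_const measurable_monomial) simp
    have "(\<integral>\<^sup>+\<xi>. (SUP x\<in>{1::nat..}.
          ennreal (norm (\<Sum>n=1..x. a n / complex_of_real (real n powr u) * \<xi> n))) \<partial>Xi_haar)
        = (\<integral>\<^sup>+\<xi>. h (prime_values \<xi>) \<partial>Xi_haar)"
    proof (rule nn_integral_cong)
      fix \<xi> assume "\<xi> \<in> space Xi_haar"
      then have "\<xi> \<in> Xi" by (simp add: Xi_haar_def)
      then show "(SUP x\<in>{1::nat..}.
          ennreal (norm (\<Sum>n=1..x. a n / complex_of_real (real n powr u) * \<xi> n))) = h (prime_values \<xi>)"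
        by (simp only: h_def dirichlet_partial_sum[OF lift])
    qed
    also have "\<dots> = (\<integral>\<^sup>+z. h z \<partial>torus)"
      by (rule nn_integral_Xi_haar[OF h])
    \<comment> \<open>The cutoffs \<open>x + 1\<close> with integer \<open>x\<close> are among the
      positive reals.\<close>
    also have "\<dots> \<le> (\<integral>\<^sup>+z. (SUP x\<in>{0::real<..}. ennreal (norm (?S x z))) \<partial>torus)"
      unfolding h_def by (intro nn_integral_mono SUP_least SUP_upper) simp
    also have "\<dots> \<le> ennreal (C * L1_norm f)"
      using lift by (intro torus) (simp add: bohr_lift_def)
    finally show ?thesis by (simp add: dirichlet_H1_norm_def f_def)
  qed
  then show ?thesis
    by (intro exI[of _ C] conjI ballI C torus)
qed

end
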